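(* For every fixed positive integer $d$, $Z^A_d(n)=\Theta(n^{-(d-2)})$ as $n\to\infty$; that is, there are constants $c_1,c_2>0$ depending only on $d$ such that $c_1 n^{-(d-2)}\le Z^A_d(n)\le c_2 n^{-(d-2)}$ for all sufficiently large $n$.
   Context: Let $X=[n]^d$, where $[n]=\{1,\dots,n\}$, and let $\xi_x$ ($x\in X$) be independent $\mathrm{Exp}(1)$ (exponential with mean 1) random variables. An axial assignment is a set $S\subseteq X$ that meets each axis-parallel hyperplane $\{x\in X: x_i=a\}$ ($i\in[d]$, $a\in[n]$) exactly once. Define \[ Z^A_d(n)=\mathbb{E}\Big[\min_S\sum_{x\in S}\xi_x\Big], \] where the minimum is over all axial assignments $S$. *)

theory Defs
  imports "HOL-Probability.Probability"
begin

definition cube :: "nat \<Rightarrow> nat \<Rightarrow> (nat \<Rightarrow> nat) set" where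
  "cube d n = {1..d} \<rightarrow>\<^sub>E {1..n}"

definition axis_hyperplane :: "nat \<Rightarrow> nat \<Rightarrow> nat \<Rightarrow> nat \<Rightarrow> (nat \<Rightarrow> nat) set" where
  "axis_hyperplane d n i a = {x \<in> cube d n. x i = a}"

definition axial_assignment :: "nat \<Rightarrow> nat \<Rightarrow> (nat \<Rightarrow> nat) set \<Rightarrow> bool" where
  "axial_assignment d n S \<longleftrightarrow>
     S \<subseteq> cube d n \<and>
     (\<forall>i\<in>{1..d}. \<forall>a\<in>{1..n}. \<exists>!x. x \<in> S \<inter> axis_hyperplane d n i a)"

definition min_axial_cost :: "nat \<Rightarrow> nat \<Rightarrow> ((nat \<Rightarrow> nat) \<Rightarrow> real) \<Rightarrow> real" where
  "min_axial_cost d n \<xi> = Min ((\<lambda>S. \<Sum>x\<in>S. \<xi> x) ` {S. axial_assignment d n S})"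

text \<open>
  The canonical model of the weights: under this product measure the coordinates
  \<open>\<lambda>\<xi>. \<xi> x\<close>, for \<open>x\<close> in the cube, are independent and exponentially distributed with mean 1.
  Lemma \<open>expectation_min_axial_cost\<close> below shows that any other family of independent
  \<open>Exp(1)\<close> variables gives the same expectation.
\<close>
definition exp_weights :: "nat \<Rightarrow> nat \<Rightarrow> ((nat \<Rightarrow> nat) \<Rightarrow> real) measure" where
  "exp_weights d n = (\<Pi>\<^sub>M x\<in>cube d n. density lborel (exponential_density 1))"

definition Z_axial :: "nat \<Rightarrow> nat \<Rightarrow> real" where
  "Z_axial d n = (\<integral>\<xi>. min_axial_cost d n \<xi> \<partial>exp_weights d n)"

lemma finite_cube: "finite (cube d n)"
  by (simp add: cube_def finite_PiE)

lemma finite_axial_assignments: "finite {S. axial_assignment d n S}"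
  by (rule finite_subset[of _ "Pow (cube d n)"]) (auto simp: axial_assignment_def finite_cube)

lemma axial_assignments_nonempty: "{S. axial_assignment d n S} \<noteq> {}"
proof -
  have "axial_assignment d n ((\<lambda>a. \<lambda>i\<in>{1..d}. a) ` {1..n})"
    unfolding axial_assignment_def
  proof (intro conjI ballI)
    show "(\<lambda>a. \<lambda>i\<in>{1..d}. a) ` {1..n} \<subseteq> cube d n"
      by (auto simp: cube_def)
  next
    fix i a assume "i \<in> {1..d}" "a \<in> {1..n}"
    then show "\<exists>!x. x \<in> (\<lambda>a. \<lambda>i\<in>{1..d}. a) ` {1..n} \<inter> axis_hyperplane d n i a"
      by (intro ex1I[of _ "\<lambda>i\<in>{1..d}. a"]) (auto simp: axis_hyperplane_def cube_def)
  qed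
  then show ?thesis by blast
qed

lemma measurable_min_axial_cost:
  "min_axial_cost d n \<in> borel_measurable (\<Pi>\<^sub>M x\<in>cube d n. borel)"
  unfolding min_axial_cost_def
  by (intro borel_measurable_Min borel_measurable_sum measurable_component_singleton
        finite_axial_assignments)
     (auto simp: axial_assignment_def)

theorem (in prob_space) expectation_min_axial_cost:
  assumes n: "n > 0"
    and indep: "indep_vars (\<lambda>_. borel) \<xi> (cube d n)"
    and exp1: "\<And>x. x \<in> cube d n \<Longrightarrow> distributed M lborel (\<xi> x) (exponential_density 1)"
  shows "integrable M (\<lambda>\<omega>. min_axial_cost d n (\<lambda>x. \<xi> x \<omega>))"
    and "expectation (\<lambda>\<omega>. min_axial_cost d n (\<lambda>x. \<xi> x \<omega>)) = Z_axial d n"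
proof -
  let ?Y = "\<lambda>\<omega>. \<lambda>x\<in>cube d n. \<xi> x \<omega>"
  have rv [measurable]: "\<xi> x \<in> borel_measurable M" if "x \<in> cube d n" for x
    using exp1[OF that] by (simp add: distributed_def)
  have ne: "cube d n \<noteq> {}"
    using n by (auto simp: cube_def PiE_eq_empty_iff)
  have restr: "min_axial_cost d n (?Y \<omega>) = min_axial_cost d n (\<lambda>x. \<xi> x \<omega>)" for \<omega>
    unfolding min_axial_cost_def
    by (intro arg_cong[where f = Min] image_cong refl sum.cong)
       (auto simp: axial_assignment_def subset_iff)
  have Y: "?Y \<in> measurable M (\<Pi>\<^sub>M x\<in>cube d n. borel)"
    by (intro measurable_restrict rv)
  have "distr M (\<Pi>\<^sub>M x\<in>cube d n. borel) ?Y = (\<Pi>\<^sub>M x\<in>cube d n. distr M borel (\<xi> x))"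
    using indep indep_vars_iff_distr_eq_PiM'[OF ne rv, of "\<lambda>x. x"] by simp
  also have "\<dots> = exp_weights d n"
    unfolding exp_weights_def
  proof (intro PiM_cong refl)
    fix x assume "x \<in> cube d n"
    then have "distr M lborel (\<xi> x) = density lborel (exponential_density 1)"
      using exp1 by (simp add: distributed_def)
    moreover have "distr M lborel (\<xi> x) = distr M borel (\<xi> x)"
      by (intro distr_cong) auto
    ultimately show "distr M borel (\<xi> x) = density lborel (exponential_density 1)"
      by simp
  qed
  finally have D: "distr M (\<Pi>\<^sub>M x\<in>cube d n. borel) ?Y = exp_weights d n" .
  show "expectation (\<lambda>\<omega>. min_axial_cost d n (\<lambda>x. \<xi> x \<omega>)) = Z_axial d n"
    unfolding Z_axial_def D[symmetric]
    by (subst integral_distr[OF Y measurable_min_axial_cost]) (simp add: restr)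
  have int: "integrable M (\<xi> x)" if "x \<in> cube d n" for x
    by (rule erlang_ith_moment_integrable[OF _ exp1[OF that], of 1, simplified])
  have meas: "(\<lambda>\<omega>. min_axial_cost d n (\<lambda>x. \<xi> x \<omega>)) \<in> borel_measurable M"
    using measurable_comp[OF Y measurable_min_axial_cost] by (simp add: comp_def restr)
  show "integrable M (\<lambda>\<omega>. min_axial_cost d n (\<lambda>x. \<xi> x \<omega>))"
  proof (rule Bochner_Integration.integrable_bound[OF _ meas])
    show "integrable M (\<lambda>\<omega>. \<Sum>x\<in>cube d n. \<bar>\<xi> x \<omega>\<bar>)"
      by (intro Bochner_Integration.integrable_sum integrable_abs int)
    have "\<bar>min_axial_cost d n f\<bar> \<le> (\<Sum>x\<in>cube d n. \<bar>f x\<bar>)" for f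
    proof -
      have "min_axial_cost d n f \<in> (\<lambda>S. \<Sum>x\<in>S. f x) ` {S. axial_assignment d n S}"
        unfolding min_axial_cost_def
        by (intro Min_in finite_imageI finite_axial_assignments)
           (use axial_assignments_nonempty in blast)
      then obtain S where S: "S \<subseteq> cube d n" "min_axial_cost d n f = (\<Sum>x\<in>S. f x)"
        by (auto simp: axial_assignment_def)
      have "\<bar>\<Sum>x\<in>S. f x\<bar> \<le> (\<Sum>x\<in>S. \<bar>f x\<bar>)" by (rule sum_abs)
      also have "\<dots> \<le> (\<Sum>x\<in>cube d n. \<bar>f x\<bar>)"
        by (intro sum_mono2 finite_cube S) auto
      finally show ?thesis using S by simp
    qed
    then show "AE \<omega> in M. norm (min_axial_cost d n (\<lambda>x. \<xi> x \<omega>))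
        \<le> norm (\<Sum>x\<in>cube d n. \<bar>\<xi> x \<omega>\<bar>)"
      by (intro AE_I2) (simp add: sum_nonneg abs_of_nonneg)
  qed
qed

end

theory Submission
  imports Defs "HOL-Combinatorics.Permutations"
begin

text \<open>
  The lower bound is elementary: an assignment picks one point from each of the \<open>n\<close> hyperplanes
  \<open>x 1 = a\<close>, and the cheapest of the \<open>n ^ (d - 1)\<close> points of a hyperplane has mean cost
  \<open>n ^ (1 - d)\<close> (lemma \<open>Z_axial_lower\<close>).

  For the upper bound, picking points greedily is far too expensive as soon as \<open>d \<ge> 3\<close>, since the
  last few choices are made from very few points. Instead one uses that the set of all assignments is
  spread: a set \<open>U\<close> of points is contained in at most a fraction \<open>\<kappa> ^ (- card U)\<close> of the assignments,
  where \<open>\<kappa> = (n / e) ^ (d - 1)\<close> (lemma \<open>spread_tuple_graphs\<close>). For any spread family of sets of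
  size at most \<open>n\<close>, with \<open>\<kappa>\<close> at least of order \<open>sqrt n\<close>, the expected cost of the cheapest member
  is \<open>O(n / \<kappa>)\<close> (theorem \<open>nn_integral_min_cost_spread\<close>); for assignments with \<open>d \<ge> 2\<close> this is
  \<open>O(n powi (2 - d))\<close>.

  The general bound rests on what a random set \<open>W\<close> of density \<open>C / \<kappa>\<close> covers. Call the smallest remainder
  \<open>F j - W\<close> among the members \<open>F j \<subseteq> F i \<union> W\<close> the fragment of \<open>F i\<close>. A counting argument (lemma
  \<open>expected_number_of_large_fragments\<close>) shows that for almost all \<open>i\<close> the fragment is at most half
  as large as the bound on the sizes, with an error that decreases when \<open>C\<close> grows. The fragments are
  subsets of the original members, so they are spread with the same parameters, and the step can be
  repeated with a fresh random set until the fragments are empty. A member whose fragment is empty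
  in the end was bought piecewise: roughly half of it in the first round, a quarter in the second,
  and so on. As ever fewer points remain to be bought, later rounds can afford a larger \<open>C\<close>, and a higher price
  per point, in such a way that the errors add up to a small constant and the cost to \<open>O(n / \<kappa>)\<close>.

  The fresh random sets come from the fact that an exponential variable is the minimum of independent
  exponential variables of smaller rates: each round has its own family of weights, and a point is
  cheap in this round if this family gives it a small weight. The same trick, applied once more, shows
  that a bound which holds with probability \<open>3/4\<close> for weights of rate \<open>1/2\<close> holds in expectation
  for weights of rate 1 up to a factor of 2 (lemma
  \<open>nn_integral_min_cost_restart\<close>).
\<close>

section \<open>Families of independent exponential weights\<close>

definition iid_exponential :: "'a set \<Rightarrow> real \<Rightarrow> ('a \<Rightarrow> real) measure" where
  "iid_exponential X l = (\<Pi>\<^sub>M x\<in>X. density lborel (exponential_density l))"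

lemma sets_iid_exponential [measurable_cong, simp]:
  "sets (iid_exponential X l) = sets (\<Pi>\<^sub>M x\<in>X. borel)"
  unfolding iid_exponential_def by (intro sets_PiM_cong) auto

lemma space_iid_exponential: "space (iid_exponential X l) = X \<rightarrow>\<^sub>E UNIV"
  by (simp add: iid_exponential_def space_PiM)

lemma prob_space_iid_exponential: "0 < l \<Longrightarrow> prob_space (iid_exponential X l)"
  unfolding iid_exponential_def by (intro prob_space_PiM prob_space_exponential_density)

lemma distr_min_exponential:
  fixes a b :: real
  assumes "0 < a" "0 < b"
  shows "distr (density lborel (exponential_density a) \<Otimes>\<^sub>M density lborel (exponential_density b))
           borel (\<lambda>(x, y). min x y) = density lborel (exponential_density (a + b))"
    (is "distr (?A \<Otimes>\<^sub>M ?B) _ _ = _")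
proof -
  interpret A: prob_space ?A by (rule prob_space_exponential_density) fact
  interpret B: prob_space ?B by (rule prob_space_exponential_density) fact
  interpret AB: pair_prob_space ?A ?B ..
  have 1: "distr (?A \<Otimes>\<^sub>M ?B) borel fst = ?A"
    using B.distr_pair_fst[of ?A] by (metis distr_cong sets_density sets_lborel)
  have 2: "distr (?A \<Otimes>\<^sub>M ?B) borel snd = ?B"
  proof (rule measure_eqI)
    fix Y assume "Y \<in> sets (distr (?A \<Otimes>\<^sub>M ?B) borel snd)"
    then have "emeasure (distr (?A \<Otimes>\<^sub>M ?B) borel snd) Y = emeasure (?A \<Otimes>\<^sub>M ?B) (space ?A \<times> Y)"
      by (auto simp: emeasure_distr space_pair_measure intro!: arg_cong[where f = "emeasure _"])
    also have "\<dots> = emeasure ?B Y"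
      using \<open>Y \<in> _\<close> A.emeasure_space_1 by (subst B.emeasure_pair_measure_Times) auto
    finally show "emeasure (distr (?A \<Otimes>\<^sub>M ?B) borel snd) Y = emeasure ?B Y" .
  qed auto
  have "AB.indep_var borel fst borel snd"
    unfolding AB.indep_var_distribution_eq 1 2
    by (auto intro!: distr_id2[symmetric] sets_pair_measure_cong)
  moreover have "distributed (?A \<Otimes>\<^sub>M ?B) lborel fst (exponential_density a)"
    "distributed (?A \<Otimes>\<^sub>M ?B) lborel snd (exponential_density b)"
    using 1 2 by (auto simp: distributed_def cong: distr_cong)
  ultimately have "distributed (?A \<Otimes>\<^sub>M ?B) lborel (\<lambda>p. min (fst p) (snd p)) (exponential_density (a + b))"
    using assms by (intro AB.exponential_distributed_min)
  then have "distr (?A \<Otimes>\<^sub>M ?B) lborel (\<lambda>p. min (fst p) (snd p)) = density lborel (exponential_density (a + b))"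
    by (simp add: distributed_def)
  then show ?thesis
    by (metis (no_types, lifting) distr_cong sets_lborel case_prod_beta)
qed

text \<open>
  The minimum of independent exponential variables is exponential, with the sum of the rates. Read
  backwards, this splits the weights into independent layers: weights of rate \<open>a + b\<close> may be
  sampled as the pointwise minimum of two independent families of rates \<open>a\<close> and \<open>b\<close>. The argument
  exposes such layers one after another, and each new layer is fresh randomness. It suffices to
  compare the measures of boxes, and there the integral factorises over the coordinates.
\<close>
lemma iid_exponential_add:
  fixes a b :: real
  assumes X: "finite X" and "0 < a" "0 < b"
  shows "distr (iid_exponential X a \<Otimes>\<^sub>M iid_exponential X b) (\<Pi>\<^sub>M x\<in>X. borel)
           (\<lambda>(u, v). \<lambda>x\<in>X. min (u x) (v x)) = iid_exponential X (a + b)"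
    (is "?D = _")
proof -
  let ?E = "\<lambda>l. density lborel (\<lambda>x. ennreal (exponential_density l x))"
  interpret A: prob_space "?E a" by (rule prob_space_exponential_density) fact
  interpret B: prob_space "?E b" by (rule prob_space_exponential_density) fact
  interpret AB: prob_space "?E (a + b)" using assms by (intro prob_space_exponential_density) simp
  interpret PA: product_sigma_finite "\<lambda>_. ?E a" ..
  interpret PB: product_sigma_finite "\<lambda>_. ?E b" ..
  interpret PAB: product_sigma_finite "\<lambda>_. ?E (a + b)" ..
  interpret QA: prob_space "iid_exponential X a" by (rule prob_space_iid_exponential) fact
  interpret QB: prob_space "iid_exponential X b" by (rule prob_space_iid_exponential) fact
  show ?thesis
    unfolding iid_exponential_def[of X "a + b"]
  proof (rule PAB.PiM_eqI[OF X])
    show "sets ?D = sets (Pi\<^sub>M X (\<lambda>_. ?E (a + b)))"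
      by (simp add: iid_exponential_def[symmetric])
  next
    fix A assume "\<And>x. x \<in> X \<Longrightarrow> A x \<in> sets (?E (a + b))"
    then have A [measurable]: "A x \<in> sets borel" if "x \<in> X" for x
      using that by simp
    have meas [measurable]: "(\<lambda>(u, v). \<lambda>x\<in>X. min (u x) (v x)) \<in>
        measurable (iid_exponential X a \<Otimes>\<^sub>M iid_exponential X b) (\<Pi>\<^sub>M x\<in>X. borel)"
      by (simp add: split_beta) measurable
    have box: "Pi\<^sub>E X A \<in> sets (\<Pi>\<^sub>M x\<in>X. borel)"
      using X A by (intro sets_PiM_I_finite) auto
    have ind: "indicator (Pi\<^sub>E X A) (\<lambda>x\<in>X. min (u x) (v x)) =
        (\<Prod>x\<in>X. indicator (A x) (min (u x) (v x)) :: ennreal)" for u v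
      using X by (auto simp: indicator_def PiE_iff prod_zero_iff)
    have "emeasure ?D (Pi\<^sub>E X A) = (\<integral>\<^sup>+w. indicator (Pi\<^sub>E X A) w \<partial>?D)"
      by (rule nn_integral_indicator[symmetric]) (use box in \<open>simp only: sets_distr\<close>)
    also have "\<dots> = (\<integral>\<^sup>+p. indicator (Pi\<^sub>E X A) ((\<lambda>(u, v). \<lambda>x\<in>X. min (u x) (v x)) p)
        \<partial>(iid_exponential X a \<Otimes>\<^sub>M iid_exponential X b))"
      by (rule nn_integral_distr[OF meas]) (use box in simp)
    also have "\<dots> = (\<integral>\<^sup>+u. \<integral>\<^sup>+v. indicator (Pi\<^sub>E X A) (\<lambda>x\<in>X. min (u x) (v x))
        \<partial>iid_exponential X b \<partial>iid_exponential X a)"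
      using box by (subst QB.nn_integral_fst[symmetric]) (auto simp: split_beta)
    also have "\<dots> = (\<integral>\<^sup>+u. \<integral>\<^sup>+v. (\<Prod>x\<in>X. indicator (A x) (min (u x) (v x)))
        \<partial>iid_exponential X b \<partial>iid_exponential X a)"
      by (simp only: ind)
    also have "\<dots> = (\<integral>\<^sup>+u. (\<Prod>x\<in>X. \<integral>\<^sup>+y. indicator (A x) (min (u x) y) \<partial>?E b) \<partial>iid_exponential X a)"
      unfolding iid_exponential_def
      by (intro nn_integral_cong PB.product_nn_integral_prod X) measurable
    also have "\<dots> = (\<Prod>x\<in>X. \<integral>\<^sup>+z. \<integral>\<^sup>+y. indicator (A x) (min z y) \<partial>?E b \<partial>?E a)"
      unfolding iid_exponential_def
      by (intro PA.product_nn_integral_prod X) measurable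
    also have "\<dots> = (\<Prod>x\<in>X. emeasure (?E (a + b)) (A x))"
    proof (rule prod.cong[OF refl])
      fix x assume x: "x \<in> X"
      note A[OF x, measurable]
      have "emeasure (?E (a + b)) (A x) = (\<integral>\<^sup>+w. indicator (A x) w
          \<partial>distr (?E a \<Otimes>\<^sub>M ?E b) borel (\<lambda>(x, y). min x y))"
        using A[OF x] by (subst distr_min_exponential) (use assms in auto)
      also have "\<dots> = (\<integral>\<^sup>+p. indicator (A x) ((\<lambda>(x, y). min x y) p) \<partial>(?E a \<Otimes>\<^sub>M ?E b))"
        by (intro nn_integral_distr) measurable
      also have "\<dots> = (\<integral>\<^sup>+z. \<integral>\<^sup>+y. indicator (A x) (min z y) \<partial>?E b \<partial>?E a)"
        by (subst B.nn_integral_fst[symmetric]) (auto simp: split_beta)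
      finally show "(\<integral>\<^sup>+z. \<integral>\<^sup>+y. indicator (A x) (min z y) \<partial>?E b \<partial>?E a) = emeasure (?E (a + b)) (A x)" ..
    qed
    finally show "emeasure ?D (Pi\<^sub>E X A) = (\<Prod>x\<in>X. emeasure (?E (a + b)) (A x))" .
  qed
qed

lemma nn_integral_iid_exponential_add:
  fixes a b :: real
  assumes X: "finite X" and "0 < a" "0 < b"
    and g [measurable]: "g \<in> borel_measurable (\<Pi>\<^sub>M x\<in>X. borel)"
  shows "(\<integral>\<^sup>+w. g w \<partial>iid_exponential X (a + b)) =
    (\<integral>\<^sup>+u. \<integral>\<^sup>+v. g (\<lambda>x\<in>X. min (u x) (v x)) \<partial>iid_exponential X b \<partial>iid_exponential X a)"
proof -
  interpret QB: prob_space "iid_exponential X b" by (rule prob_space_iid_exponential) fact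
  have meas [measurable]: "(\<lambda>(u, v). \<lambda>x\<in>X. min (u x) (v x)) \<in>
      measurable (iid_exponential X a \<Otimes>\<^sub>M iid_exponential X b) (\<Pi>\<^sub>M x\<in>X. borel)"
    by (simp add: split_beta) measurable
  show ?thesis
    unfolding iid_exponential_add[OF assms(1-3), symmetric]
    by (subst nn_integral_distr, measurable) (subst QB.nn_integral_fst[symmetric], auto simp: split_beta)
qed

text \<open>
  Changing the rate only rescales the weights. This turns the expected minimum cost at rate
  \<open>1/2\<close>, which appears after a failed first layer, back into the one at rate 1.
\<close>
lemma iid_exponential_scale:
  fixes l c :: real
  assumes X: "finite X" and l: "0 < l" and c: "0 < c"
  shows "distr (iid_exponential X l) (\<Pi>\<^sub>M x\<in>X. borel) (\<lambda>w. \<lambda>x\<in>X. c * w x) = iid_exponential X (l / c)"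
proof -
  let ?E = "\<lambda>l. density lborel (\<lambda>x. ennreal (exponential_density l x))"
  interpret L: prob_space "?E l" by (rule prob_space_exponential_density) fact
  have D: "distributed (?E l) lborel (\<lambda>x. x) (exponential_density l)"
    by (auto simp: distributed_def intro!: distr_id2)
  have "distributed (?E l) lborel (\<lambda>x. c * x) (exponential_density (l / c))"
  proof (subst L.exponential_distributed_iff, safe)
    fix t :: real assume t: "0 \<le> t"
    have "{x. c * x \<le> t} = {x. x \<le> t / c}"
      using c by (auto simp: field_simps)
    then have "measure (?E l) {x \<in> space (?E l). c * x \<le> t} = measure (?E l) {x \<in> space (?E l). x \<le> t / c}"
      by simp
    also have "\<dots> = 1 - exp (- (t / c) * l)"
      using t c l by (intro L.exponential_distributedD_le[OF D]) auto
    finally show "measure (?E l) {x \<in> space (?E l). c * x \<le> t} = 1 - exp (- t * (l / c))"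
      by simp
  qed (use l c in auto)
  then have 1: "distr (?E l) borel (\<lambda>x. c * x) = ?E (l / c)"
    by (metis distr_cong sets_lborel distributed_distr_eq_density)
  have "distr (PiM X (\<lambda>_. ?E l)) (\<Pi>\<^sub>M x\<in>X. borel) (compose X ((*) c)) =
      distr (PiM X (\<lambda>_. ?E l)) (PiM X (\<lambda>_. ?E l)) (compose X ((*) c))"
    by (intro distr_cong sets_PiM_cong) auto
  also have "\<dots> = PiM X (\<lambda>_. distr (?E l) (?E l) ((*) c))"
    using X L.prob_space_axioms by (intro distr_PiM_finite_prob_space') auto
  also have "distr (?E l) (?E l) ((*) c) = ?E (l / c)"
    unfolding 1[symmetric] by (intro distr_cong) auto
  finally show ?thesis
    unfolding iid_exponential_def compose_def .
qed

section \<open>Fragments in spread families\<close>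

text \<open>
  The probability that the random subset of \<open>X\<close> which contains each point independently with
  probability \<open>p\<close> equals \<open>W\<close>. Only finitely many sets \<open>W\<close> occur, so finite sums serve as
  expectations over this subset.
\<close>
definition bernoulli_weight :: "real \<Rightarrow> 'a set \<Rightarrow> 'a set \<Rightarrow> real" where
  "bernoulli_weight p X W = p ^ card W * (1 - p) ^ card (X - W)"

lemma bernoulli_weight_nonneg: "0 \<le> p \<Longrightarrow> p \<le> 1 \<Longrightarrow> 0 \<le> bernoulli_weight p X W"
  by (simp add: bernoulli_weight_def)

lemma sum_bernoulli_weight: "finite X \<Longrightarrow> (\<Sum>W\<in>Pow X. bernoulli_weight p X W) = 1"
  using prod_add[of X "\<lambda>_. p" "\<lambda>_. 1 - p"] by (simp add: bernoulli_weight_def)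

lemma bernoulli_weight_Diff_le:
  assumes "finite X" "Z \<subseteq> X" "T \<subseteq> Z" and p: "0 < p" "p \<le> 1"
  shows "bernoulli_weight p X (Z - T) \<le> bernoulli_weight p X Z / p ^ card T"
proof -
  have fin: "finite Z" "finite T"
    using assms by (meson finite_subset)+
  have "X - (Z - T) = (X - Z) \<union> T"
    using assms by blast
  moreover have "card ((X - Z) \<union> T) = card (X - Z) + card T"
    using assms fin by (intro card_Un_disjoint) auto
  ultimately have "card (X - (Z - T)) = card (X - Z) + card T"
    by simp
  moreover have "card Z = card (Z - T) + card T"
    using card_Diff_subset[OF fin(2) assms(3)] card_mono[OF fin(1) assms(3)] by linarith
  ultimately have "bernoulli_weight p X (Z - T) = bernoulli_weight p X Z / p ^ card T * (1 - p) ^ card T"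
    using p by (simp add: bernoulli_weight_def power_add)
  also have "\<dots> \<le> bernoulli_weight p X Z / p ^ card T * 1"
    using p by (intro mult_left_mono power_le_one divide_nonneg_nonneg bernoulli_weight_nonneg) auto
  finally show ?thesis by simp
qed

text \<open>
  In the literature a family of sets is called \<open>k\<close>-spread if at most a fraction \<open>1 / k ^ card U\<close>
  of its members contains a given set \<open>U\<close>. Here the members are indexed, so that they may repeat,
  and the bound refers to a fixed number \<open>m\<close> instead of the size of \<open>I\<close>. In this form the property
  survives when members are discarded or shrunk, with the same \<open>m\<close> and \<open>k\<close>; the loss is visible
  only in the gap between \<open>card I\<close> and \<open>m\<close>.
\<close>
definition spread_family :: "real \<Rightarrow> real \<Rightarrow> 'i set \<Rightarrow> ('i \<Rightarrow> 'a set) \<Rightarrow> bool" where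
  "spread_family m k I F \<longleftrightarrow> finite I \<and>
     (\<forall>U. finite U \<longrightarrow> real (card {i \<in> I. U \<subseteq> F i}) \<le> m / k ^ card U)"

lemma spread_family_shrink:
  assumes "spread_family m k I F" "J \<subseteq> I" "\<And>i. i \<in> J \<Longrightarrow> G i \<subseteq> F i"
  shows "spread_family m k J G"
  unfolding spread_family_def
proof (intro conjI allI impI)
  show "finite J"
    using assms finite_subset unfolding spread_family_def by blast
  fix U :: "'b set" assume U: "finite U"
  have "card {i \<in> J. U \<subseteq> G i} \<le> card {i \<in> I. U \<subseteq> F i}"
  proof (rule card_mono)
    show "finite {i \<in> I. U \<subseteq> F i}"
      using assms(1) by (simp add: spread_family_def)
    show "{i \<in> J. U \<subseteq> G i} \<subseteq> {i \<in> I. U \<subseteq> F i}"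
      using assms(2,3) by blast
  qed
  with U assms(1) show "real (card {i \<in> J. U \<subseteq> G i}) \<le> m / k ^ card U"
    unfolding spread_family_def by (meson of_nat_le_iff order_trans)
qed

lemma spread_family_card_le: "spread_family m k I F \<Longrightarrow> real (card I) \<le> m"
  unfolding spread_family_def by (elim conjE allE[of _ "{}"]) simp

text \<open>
  Suppose that the points of \<open>W\<close> are already cheap and that one is ready to pay for the points of
  \<open>F i\<close>. Then every member \<open>F j\<close> with \<open>F j \<subseteq> F i \<union> W\<close> is a candidate solution, and the best
  one leaves the fewest points outside \<open>W\<close> to be paid for. The fragment is the set of those points.
\<close>
definition fragment_source :: "'i set \<Rightarrow> ('i \<Rightarrow> 'a set) \<Rightarrow> 'a set \<Rightarrow> 'i \<Rightarrow> 'i" where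
  "fragment_source I F W i = arg_min (\<lambda>j. card (F j - W)) (\<lambda>j. j \<in> I \<and> F j \<subseteq> F i \<union> W)"

definition fragment :: "'i set \<Rightarrow> ('i \<Rightarrow> 'a set) \<Rightarrow> 'a set \<Rightarrow> 'i \<Rightarrow> 'a set" where
  "fragment I F W i = F (fragment_source I F W i) - W"

lemma fragment_source:
  assumes "i \<in> I"
  shows "fragment_source I F W i \<in> I" "F (fragment_source I F W i) \<subseteq> F i \<union> W"
    and "\<And>j. j \<in> I \<Longrightarrow> F j \<subseteq> F i \<union> W \<Longrightarrow> card (fragment I F W i) \<le> card (F j - W)"
  using arg_min_nat_lemma[of "\<lambda>j. j \<in> I \<and> F j \<subseteq> F i \<union> W" i "\<lambda>j. card (F j - W)"] assms
  by (auto simp: fragment_def fragment_source_def)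

lemma fragment_subset: "i \<in> I \<Longrightarrow> fragment I F W i \<subseteq> F i"
  using fragment_source(2)[of i I F W] by (auto simp: fragment_def)

text \<open>
  By minimality, a member that lives inside \<open>W\<close> and the fragment cannot leave out any point of the
  fragment. Hence any covered member at all, chosen without knowledge of \<open>W\<close> and \<open>i\<close>, contains the
  fragment.
\<close>
lemma fragment_subset_any_covered:
  assumes "i \<in> I" "j \<in> I" "finite (F i)" "F j \<subseteq> W \<union> fragment I F W i"
  shows "fragment I F W i \<subseteq> F j"
proof -
  have "F j - W \<subseteq> fragment I F W i"
    using assms(4) by auto
  moreover have "card (fragment I F W i) \<le> card (F j - W)"
    using assms(4) fragment_subset[OF assms(1), of F W] by (intro fragment_source assms) auto
  moreover have "finite (fragment I F W i)"
    using fragment_subset assms finite_subset by metis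
  ultimately have "F j - W = fragment I F W i"
    by (intro card_seteq) auto
  then show ?thesis by auto
qed

text \<open>
  A pair \<open>(W, i)\<close> with fragment \<open>T\<close> is recorded as \<open>(W \<union> T, T, i)\<close>, from which \<open>W\<close> is
  recovered because \<open>T\<close> is disjoint from \<open>W\<close>. Such a triple has few possible values. For given
  \<open>Z = W \<union> T\<close>, some member inside \<open>Z\<close> can be selected as a function of \<open>Z\<close> alone, and it contains
  \<open>T\<close>; this leaves at most \<open>2 ^ l\<close> sets \<open>T\<close>. For given \<open>T\<close>, spread leaves at most
  \<open>m / k ^ card T\<close> indices \<open>i\<close>. Replacing \<open>W\<close> by \<open>Z\<close> costs a factor of at most \<open>1 / p ^ card T\<close>
  in probability, so the triples with given \<open>Z\<close> and \<open>T\<close>, where \<open>card T \<ge> t\<close>, contribute at most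
  \<open>m / C ^ t\<close> times the probability of \<open>Z\<close>.
\<close>
lemma expected_number_of_large_fragments:
  fixes p k C m :: real
  assumes X: "finite X" and FX: "\<And>i. i \<in> I \<Longrightarrow> F i \<subseteq> X" and l: "\<And>i. i \<in> I \<Longrightarrow> card (F i) \<le> l"
    and spread: "spread_family m k I F"
    and p: "0 < p" "p \<le> 1" and k: "0 < k" and C: "1 \<le> C" "C \<le> p * k" and m: "0 \<le> m"
  shows "(\<Sum>W\<in>Pow X. bernoulli_weight p X W * real (card {i \<in> I. t \<le> card (fragment I F W i)}))
    \<le> m * 2 ^ l / C ^ t"
proof -
  let ?w = "bernoulli_weight p X"
  have I: "finite I"
    using spread by (simp add: spread_family_def)
  define c where "c Z = (SOME j. j \<in> I \<and> F j \<subseteq> Z)" for Z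
  define covering where "covering = {Z \<in> Pow X. \<exists>j\<in>I. F j \<subseteq> Z}"
  have c: "c Z \<in> I \<and> F (c Z) \<subseteq> Z" if "Z \<in> covering" for Z
    unfolding c_def by (rule someI_ex) (use that in \<open>auto simp: covering_def\<close>)
  define Ts where "Ts Z = {T \<in> Pow (F (c Z)). t \<le> card T}" for Z
  let ?B = "SIGMA W:Pow X. {i \<in> I. t \<le> card (fragment I F W i)}"
  let ?D = "SIGMA Z:covering. SIGMA T:Ts Z. {i \<in> I. T \<subseteq> F i}"
  let ?enc = "\<lambda>(W, i). (W \<union> fragment I F W i, fragment I F W i, i)"
  have finF: "finite (F i)" if "i \<in> I" for i
    using X FX[OF that] finite_subset by blast
  have finC: "finite covering"
    using X by (auto simp: covering_def)
  have finT: "finite (Ts Z)" if "Z \<in> covering" for Z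
    using c[OF that] finF by (auto simp: Ts_def)
  have inj: "inj_on ?enc ?B"
  proof (rule inj_onI)
    fix a b assume ab: "?enc a = ?enc b"
    obtain W i V j where eqs: "a = (W, i)" "b = (V, j)"
      by (cases a, cases b)
    have "W = (W \<union> fragment I F W i) - fragment I F W i"
      "V = (V \<union> fragment I F V j) - fragment I F V j"
      by (auto simp: fragment_def)
    moreover from ab have "W \<union> fragment I F W i = V \<union> fragment I F V j \<and>
      fragment I F W i = fragment I F V j \<and> i = j"
      unfolding eqs prod.case prod.inject .
    ultimately show "a = b" unfolding eqs by (metis (no_types))
  qed
  have enc: "?enc ` ?B \<subseteq> ?D"
  proof (rule image_subsetI)
    fix b assume "b \<in> ?B"
    then obtain W i where b: "b = (W, i)" and W: "W \<in> Pow X" and i: "i \<in> I"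
      and t: "t \<le> card (fragment I F W i)"
      by blast
    let ?T = "fragment I F W i"
    have "?T \<subseteq> F i"
      by (rule fragment_subset) fact
    have Z: "W \<union> ?T \<in> covering"
      unfolding covering_def using W FX[OF i] \<open>?T \<subseteq> F i\<close> fragment_source(1)[OF i, of F W]
      by (auto simp: fragment_def intro!: bexI[of _ "fragment_source I F W i"])
    have "?T \<subseteq> F (c (W \<union> ?T))"
      using c[OF Z] i finF by (intro fragment_subset_any_covered) auto
    with Z t i \<open>?T \<subseteq> F i\<close> show "?enc b \<in> ?D"
      by (simp add: b Ts_def)
  qed
  have "(\<Sum>W\<in>Pow X. ?w W * real (card {i \<in> I. t \<le> card (fragment I F W i)}))
      = (\<Sum>W\<in>Pow X. \<Sum>i\<in>{i \<in> I. t \<le> card (fragment I F W i)}. ?w W)"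
    by (simp add: mult.commute)
  also have "\<dots> = (\<Sum>(W, i)\<in>?B. ?w W)"
    using X I by (subst sum.Sigma) auto
  also have "\<dots> = (\<Sum>b\<in>?B. (\<lambda>(Z, T, i). ?w (Z - T)) (?enc b))"
  proof (rule sum.cong[OF refl], clarify)
    fix W i
    have "W \<union> fragment I F W i - fragment I F W i = W"
      by (auto simp: fragment_def)
    then show "?w W = ?w (W \<union> fragment I F W i - fragment I F W i)" by simp
  qed
  also have "\<dots> = (\<Sum>(Z, T, i)\<in>?enc ` ?B. ?w (Z - T))"
    by (subst sum.reindex[OF inj]) (simp add: comp_def)
  also have "\<dots> \<le> (\<Sum>(Z, T, i)\<in>?D. ?w (Z - T))"
  proof (rule sum_mono2[OF _ enc])
    show "finite ?D"
      using finC finT I by (intro finite_SigmaI) auto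
  qed (use p in \<open>auto simp: bernoulli_weight_nonneg\<close>)
  also have "\<dots> = (\<Sum>Z\<in>covering. \<Sum>T\<in>Ts Z. real (card {i \<in> I. T \<subseteq> F i}) * ?w (Z - T))"
  proof -
    have "(\<Sum>(Z, T, i)\<in>?D. ?w (Z - T)) =
        (\<Sum>Z\<in>covering. \<Sum>(T, i)\<in>(SIGMA T:Ts Z. {i \<in> I. T \<subseteq> F i}). ?w (Z - T))"
      by (rule sum.Sigma[symmetric]) (use finC finT I in auto)
    also have "\<dots> = (\<Sum>Z\<in>covering. \<Sum>T\<in>Ts Z. \<Sum>i\<in>{i \<in> I. T \<subseteq> F i}. ?w (Z - T))"
      by (intro sum.cong refl sum.Sigma[symmetric]) (use finT I in auto)
    finally show ?thesis by simp
  qed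
  also have "\<dots> \<le> (\<Sum>Z\<in>covering. \<Sum>T\<in>Ts Z. ?w Z * (m / C ^ t))"
  proof (intro sum_mono)
    fix Z T assume Z: "Z \<in> covering" and T: "T \<in> Ts Z"
    have "T \<subseteq> F (c Z)" "t \<le> card T" "finite T"
      using T c[OF Z] finF finite_subset by (auto simp: Ts_def)
    have w: "?w (Z - T) \<le> ?w Z / p ^ card T"
      using X Z c[OF Z] \<open>T \<subseteq> F (c Z)\<close> p by (intro bernoulli_weight_Diff_le) (auto simp: covering_def)
    have "real (card {i \<in> I. T \<subseteq> F i}) * ?w (Z - T) \<le> (m / k ^ card T) * (?w Z / p ^ card T)"
      using spread \<open>finite T\<close> k m p by (intro mult_mono w) (auto simp: spread_family_def intro!: bernoulli_weight_nonneg)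
    also have "\<dots> = ?w Z * (m / (p * k) ^ card T)"
      by (simp add: power_mult_distrib mult_ac)
    also have "\<dots> \<le> ?w Z * (m / C ^ t)"
    proof -
      have "C ^ t \<le> C ^ card T"
        using C \<open>t \<le> card T\<close> by (intro power_increasing) auto
      also have "\<dots> \<le> (p * k) ^ card T"
        using C by (intro power_mono) auto
      finally show ?thesis
        using C m p by (intro mult_left_mono divide_left_mono bernoulli_weight_nonneg)
          (auto intro!: mult_pos_pos zero_less_power)
    qed
    finally show "real (card {i \<in> I. T \<subseteq> F i}) * ?w (Z - T) \<le> ?w Z * (m / C ^ t)" .
  qed
  also have "\<dots> = (\<Sum>Z\<in>covering. real (card (Ts Z)) * (?w Z * (m / C ^ t)))"
    by simp
  also have "\<dots> \<le> (\<Sum>Z\<in>covering. 2 ^ l * (?w Z * (m / C ^ t)))"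
  proof (intro sum_mono mult_right_mono)
    fix Z assume Z: "Z \<in> covering"
    have "card (Ts Z) \<le> card (Pow (F (c Z)))"
      using c[OF Z] finF by (intro card_mono) (auto simp: Ts_def)
    also have "\<dots> \<le> 2 ^ l"
      using c[OF Z] finF l by (auto simp: card_Pow intro!: power_increasing)
    finally show "real (card (Ts Z)) \<le> 2 ^ l"
      by (metis of_nat_le_iff of_nat_numeral of_nat_power)
    show "0 \<le> ?w Z * (m / C ^ t)"
      using p C m by (intro mult_nonneg_nonneg divide_nonneg_nonneg bernoulli_weight_nonneg) auto
  qed
  also have "\<dots> = (m * 2 ^ l / C ^ t) * (\<Sum>Z\<in>covering. ?w Z)"
    by (subst sum_distrib_left) (intro sum.cong refl, simp)
  also have "\<dots> \<le> (m * 2 ^ l / C ^ t) * (\<Sum>Z\<in>Pow X. ?w Z)"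
    using X p m C by (intro mult_left_mono sum_mono2) (auto simp: covering_def intro!: bernoulli_weight_nonneg)
  finally show ?thesis
    by (simp add: sum_bernoulli_weight X)
qed

section \<open>Points of small weight in one exponential layer\<close>

lemma emeasure_exponential_density:
  fixes l b :: real
  assumes l: "0 < l" and b: "0 \<le> b"
  shows "emeasure (density lborel (exponential_density l)) {..b} = ennreal (1 - exp (- l * b))"
    and "emeasure (density lborel (exponential_density l)) {b<..} = ennreal (exp (- l * b))"
proof -
  let ?E = "density lborel (exponential_density l)"
  interpret prob_space ?E by (rule prob_space_exponential_density) fact
  have D: "distributed ?E lborel (\<lambda>x. x) (exponential_density l)"
    by (auto simp: distributed_def intro!: distr_id2)
  have s: "{x \<in> space ?E. x \<le> b} = {..b}" "{x \<in> space ?E. b < x} = {b<..}"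
    by auto
  have "measure ?E {..b} = 1 - exp (- l * b)"
    using exponential_distributedD_le[OF D b l] unfolding s by (metis minus_mult_commute mult.commute)
  then show "emeasure ?E {..b} = ennreal (1 - exp (- l * b))"
    by (simp only: emeasure_eq_measure)
  have "measure ?E {b<..} = exp (- l * b)"
    using exponential_distributedD_gt[OF D b l] unfolding s by (metis minus_mult_commute mult.commute)
  then show "emeasure ?E {b<..} = ennreal (exp (- l * b))"
    by (simp only: emeasure_eq_measure)
qed

text \<open>
  In one exponential layer of rate \<open>l\<close>, the set of points of weight at most \<open>b\<close> is a random
  subset of the Bernoulli kind, with \<open>p = 1 - exp (- l * b)\<close>.
\<close>
lemma emeasure_sublevel_set_eq:
  fixes l b :: real
  assumes X: "finite X" and W: "W \<subseteq> X" and l: "0 < l" and b: "0 \<le> b"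
  shows "emeasure (iid_exponential X l) {w \<in> space (iid_exponential X l). {x \<in> X. w x \<le> b} = W}
    = ennreal (bernoulli_weight (1 - exp (- l * b)) X W)"
    and "{w \<in> space (iid_exponential X l). {x \<in> X. w x \<le> b} = W} \<in> sets (iid_exponential X l)"
proof -
  let ?E = "density lborel (\<lambda>x. ennreal (exponential_density l x))"
  let ?A = "\<lambda>x. if x \<in> W then {..b} else {b<..}"
  interpret E: prob_space ?E by (rule prob_space_exponential_density) fact
  interpret P: product_sigma_finite "\<lambda>_. ?E" ..
  have box: "{w \<in> space (iid_exponential X l). {x \<in> X. w x \<le> b} = W} = Pi\<^sub>E X ?A"
  proof (intro set_eqI iffI)
    fix w assume "w \<in> {w \<in> space (iid_exponential X l). {x \<in> X. w x \<le> b} = W}"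
    then show "w \<in> Pi\<^sub>E X ?A"
      by (auto simp: space_iid_exponential PiE_iff)
  next
    fix w assume w: "w \<in> Pi\<^sub>E X ?A"
    have "w x \<le> b \<longleftrightarrow> x \<in> W" if "x \<in> X" for x
      using PiE_mem[OF w that] by (cases "x \<in> W") auto
    then have "{x \<in> X. w x \<le> b} = W"
      using W by blast
    with w show "w \<in> {w \<in> space (iid_exponential X l). {x \<in> X. w x \<le> b} = W}"
      by (auto simp: space_iid_exponential PiE_iff)
  qed
  have "emeasure (PiM X (\<lambda>_. ?E)) (Pi\<^sub>E X ?A) = (\<Prod>x\<in>X. emeasure ?E (?A x))"
    using X by (intro P.emeasure_PiM) auto
  also have "\<dots> = (\<Prod>x\<in>X. ennreal (if x \<in> W then 1 - exp (- l * b) else exp (- l * b)))"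
    using emeasure_exponential_density[OF l b] by (intro prod.cong) auto
  also have "\<dots> = ennreal (\<Prod>x\<in>X. if x \<in> W then 1 - exp (- l * b) else exp (- l * b))"
    using l b by (intro prod_ennreal) auto
  also have "(\<Prod>x\<in>X. if x \<in> W then 1 - exp (- l * b) else exp (- l * b))
      = bernoulli_weight (1 - exp (- l * b)) X W"
  proof -
    have "X \<inter> {x. x \<in> W} = W" "X \<inter> - {x. x \<in> W} = X - W"
      using W by auto
    then show ?thesis
      using X by (simp add: prod.If_cases bernoulli_weight_def)
  qed
  finally show "emeasure (iid_exponential X l) {w \<in> space (iid_exponential X l). {x \<in> X. w x \<le> b} = W}
    = ennreal (bernoulli_weight (1 - exp (- l * b)) X W)"
    unfolding box by (simp add: iid_exponential_def)
  show "{w \<in> space (iid_exponential X l). {x \<in> X. w x \<le> b} = W} \<in> sets (iid_exponential X l)"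
    unfolding box sets_iid_exponential using X by (intro sets_PiM_I_finite) auto
qed

lemma nn_integral_sublevel_set:
  fixes l b :: real and h :: "'a set \<Rightarrow> ennreal"
  assumes X: "finite X" and l: "0 < l" and b: "0 \<le> b"
  shows "(\<integral>\<^sup>+w. h {x \<in> X. w x \<le> b} \<partial>iid_exponential X l) =
    (\<Sum>W\<in>Pow X. ennreal (bernoulli_weight (1 - exp (- l * b)) X W) * h W)"
proof -
  let ?P = "iid_exponential X l"
  let ?box = "\<lambda>W. {w \<in> space ?P. {x \<in> X. w x \<le> b} = W}"
  have "(\<integral>\<^sup>+w. h {x \<in> X. w x \<le> b} \<partial>?P) = (\<integral>\<^sup>+w. (\<Sum>W\<in>Pow X. h W * indicator (?box W) w) \<partial>?P)"
  proof (rule nn_integral_cong)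
    fix w assume w: "w \<in> space ?P"
    have "(\<Sum>W\<in>Pow X. h W * indicator (?box W) w) = (\<Sum>W\<in>Pow X. if {x \<in> X. w x \<le> b} = W then h W else 0)"
      using w by (intro sum.cong) (auto simp: indicator_def)
    also have "\<dots> = h {x \<in> X. w x \<le> b}"
      using X by (subst sum.delta') auto
    finally show "h {x \<in> X. w x \<le> b} = (\<Sum>W\<in>Pow X. h W * indicator (?box W) w)" ..
  qed
  also have "\<dots> = (\<Sum>W\<in>Pow X. \<integral>\<^sup>+w. h W * indicator (?box W) w \<partial>?P)"
    by (intro nn_integral_sum borel_measurable_times_ennreal borel_measurable_indicator
          emeasure_sublevel_set_eq X l b) auto
  also have "\<dots> = (\<Sum>W\<in>Pow X. ennreal (bernoulli_weight (1 - exp (- l * b)) X W) * h W)"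
  proof (rule sum.cong[OF refl])
    fix W assume "W \<in> Pow X"
    then have W: "W \<subseteq> X" by simp
    show "(\<integral>\<^sup>+w. h W * indicator (?box W) w \<partial>?P) = ennreal (bernoulli_weight (1 - exp (- l * b)) X W) * h W"
      by (subst nn_integral_cmult_indicator[OF emeasure_sublevel_set_eq(2)[OF X W l b]])
         (subst emeasure_sublevel_set_eq(1)[OF X W l b], rule mult.commute)
  qed
  finally show ?thesis .
qed

definition all_costly :: "'a set \<Rightarrow> 'i set \<Rightarrow> ('i \<Rightarrow> 'a set) \<Rightarrow> real \<Rightarrow> ('a \<Rightarrow> real) set" where
  "all_costly X I F a = {w \<in> X \<rightarrow>\<^sub>E UNIV. \<forall>i\<in>I. a < (\<Sum>x\<in>F i. w x)}"

lemma sets_all_costly [measurable]: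
  assumes "finite I" "\<And>i. i \<in> I \<Longrightarrow> F i \<subseteq> X"
  shows "all_costly X I F a \<in> sets (\<Pi>\<^sub>M x\<in>X. (borel :: real measure))"
proof -
  have [measurable]: "(\<lambda>w. \<Sum>x\<in>F i. w x) \<in> borel_measurable (\<Pi>\<^sub>M x\<in>X. (borel :: real measure))"
    if "i \<in> I" for i
    using assms(2)[OF that] by (intro borel_measurable_sum measurable_component_singleton) auto
  have "{w \<in> space (\<Pi>\<^sub>M x\<in>X. (borel :: real measure)). \<forall>i\<in>I. a < (\<Sum>x\<in>F i. w x)}
      \<in> sets (\<Pi>\<^sub>M x\<in>X. (borel :: real measure))"
    using assms(1) by measurable
  then show ?thesis
    by (simp add: all_costly_def space_PiM)
qed

text \<open>
  One round of the argument. Expose a layer of rate \<open>v\<close> and let \<open>W\<close> be its points of weight at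
  most \<open>b\<close>. If, in the remaining layer of rate \<open>u\<close>, some fragment costs at most \<open>a\<close>, then the
  member from which this fragment comes costs at most \<open>a + b * L\<close> altogether, since its other
  points lie in \<open>W\<close>. So the members can all be costly only if the fragments are, and this remains
  true after the fragments of size at least \<open>t\<close> have been thrown away.
\<close>
lemma emeasure_all_costly_fragments:
  fixes a b u v L :: real
  assumes X: "finite X" and I: "finite I" and FX: "\<And>i. i \<in> I \<Longrightarrow> F i \<subseteq> X"
    and L: "\<And>i. i \<in> I \<Longrightarrow> real (card (F i)) \<le> L"
    and u: "0 < u" and v: "0 < v" and b: "0 \<le> b"
  shows "emeasure (iid_exponential X (v + u)) (all_costly X I F (a + b * L)) \<le>
    (\<Sum>W\<in>Pow X. ennreal (bernoulli_weight (1 - exp (- v * b)) X W) *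
       emeasure (iid_exponential X u)
         (all_costly X {i \<in> I. card (fragment I F W i) < t} (fragment I F W) a))"
proof -
  let ?J = "\<lambda>W. {i \<in> I. card (fragment I F W i) < t}"
  let ?Q = "\<lambda>W. all_costly X (?J W) (fragment I F W) a"
  have [measurable]: "all_costly X I F (a + b * L) \<in> sets (\<Pi>\<^sub>M x\<in>X. (borel :: real measure))"
    using I FX by (rule sets_all_costly)
  have Q [measurable]: "?Q W \<in> sets (iid_exponential X u)" for W
    unfolding sets_iid_exponential
  proof (rule sets_all_costly)
    show "finite (?J W)"
      using I by simp
    show "fragment I F W i \<subseteq> X" if "i \<in> ?J W" for i
      using that FX fragment_subset[of i I F W] by blast
  qed
  have "emeasure (iid_exponential X (v + u)) (all_costly X I F (a + b * L)) =
      (\<integral>\<^sup>+w. indicator (all_costly X I F (a + b * L)) w \<partial>iid_exponential X (v + u))"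
    by simp
  also have "\<dots> = (\<integral>\<^sup>+y. \<integral>\<^sup>+z. indicator (all_costly X I F (a + b * L)) (\<lambda>x\<in>X. min (y x) (z x))
      \<partial>iid_exponential X u \<partial>iid_exponential X v)"
    using X u v by (intro nn_integral_iid_exponential_add) auto
  also have "\<dots> \<le> (\<integral>\<^sup>+y. \<integral>\<^sup>+z. indicator (?Q {x \<in> X. y x \<le> b}) z \<partial>iid_exponential X u \<partial>iid_exponential X v)"
  proof (intro nn_integral_mono)
    fix y z assume "y \<in> space (iid_exponential X v)" and z: "z \<in> space (iid_exponential X u)"
    let ?W = "{x \<in> X. y x \<le> b}" and ?m = "\<lambda>x\<in>X. min (y x) (z x)"
    have "z \<in> ?Q ?W" if costly: "?m \<in> all_costly X I F (a + b * L)"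
    proof (rule ccontr)
      assume "z \<notin> ?Q ?W"
      then obtain i where i: "i \<in> I" and cheap: "(\<Sum>x\<in>fragment I F ?W i. z x) \<le> a"
        using z by (auto simp: all_costly_def space_iid_exponential not_less)
      define j where "j = fragment_source I F ?W i"
      have j: "j \<in> I" "F j - ?W = fragment I F ?W i"
        using fragment_source(1)[OF i] by (auto simp: j_def fragment_def)
      have fin: "finite (F j)"
        using FX[OF j(1)] X finite_subset by blast
      \<comment> \<open>The points of the fragment are paid for in the layer z, all others in the layer y.\<close>
      have "(\<Sum>x\<in>F j. ?m x) = (\<Sum>x\<in>F j - ?W. ?m x) + (\<Sum>x\<in>F j \<inter> ?W. ?m x)"
        using fin by (subst sum.union_disjoint[symmetric]) (auto intro!: sum.cong)
      also have "\<dots> \<le> (\<Sum>x\<in>F j - ?W. z x) + (\<Sum>x\<in>F j \<inter> ?W. b)"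
        using FX[OF j(1)] by (intro add_mono sum_mono) (auto simp: min_le_iff_disj)
      also have "\<dots> \<le> a + b * L"
      proof -
        have "real (card (F j \<inter> ?W)) \<le> L"
          using L[OF j(1)] card_mono[OF fin, of "F j \<inter> ?W"] by auto
        then have "b * real (card (F j \<inter> ?W)) \<le> b * L"
          using b by (intro mult_left_mono)
        then show ?thesis
          using cheap by (simp add: j(2) mult.commute)
      qed
      finally show False
        using costly j(1) by (auto simp: all_costly_def not_less)
    qed
    then show "indicator (all_costly X I F (a + b * L)) ?m \<le> (indicator (?Q ?W) z :: ennreal)"
      by (auto simp: indicator_def)
  qed
  also have "\<dots> = (\<integral>\<^sup>+y. emeasure (iid_exponential X u) (?Q {x \<in> X. y x \<le> b}) \<partial>iid_exponential X v)"
    using Q by simp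
  also have "\<dots> = (\<Sum>W\<in>Pow X. ennreal (bernoulli_weight (1 - exp (- v * b)) X W) *
       emeasure (iid_exponential X u) (?Q W))"
    by (rule nn_integral_sublevel_set[OF X v b])
  finally show ?thesis .
qed

section \<open>Repeated passage to fragments\<close>

lemma exp_lower_half:
  fixes x :: real
  assumes "0 \<le> x" "x \<le> 1"
  shows "x / 2 \<le> 1 - exp (- x)"
proof -
  have "exp (- x) \<le> 1 / (1 + x)"
    using exp_ge_add_one_self[of x] assms by (simp add: exp_minus field_simps)
  also have "\<dots> \<le> 1 - x / 2"
  proof -
    have "x * x \<le> x"
      using assms by (simp add: mult_left_le)
    then show ?thesis
      using assms by (simp add: field_simps)
  qed
  finally show ?thesis by simp
qed

text \<open>
  Iterating the previous step: each round halves the size of the sets. The induction runs over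
  the number \<open>k\<close> of halvings still to be made, so the rounds are performed for decreasing \<open>k\<close>, and
  after the last one every fragment is empty and costs nothing.

  The round that takes sizes below \<open>2 ^ k\<close> to sizes below \<open>2 ^ (k - 1)\<close> uses a layer of rate
  \<open>G * (5/4) ^ k\<close> and a threshold that makes points cheap with probability at least
  \<open>C / \<kappa>\<close>, where \<open>C = B * (4/5) ^ k\<close>. By the bound on large fragments, it is expected to
  lose at most a fraction \<open>(4 / C) ^ (2 ^ (k - 1)) \<le> 4 / C\<close> of the initial \<open>m\<close> members, and it
  adds at most \<open>2 * B / (\<kappa> * G) * (32/25) ^ k\<close> to the cost. The three expressions in the
  statement are the geometric sums of these rates, losses and costs, up to lower order terms. For
  that each of the progressions has to grow with \<open>k\<close>; with ratio \<open>r\<close> in place of \<open>5/4\<close> the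
  costs grow like \<open>(2 / r\<^sup>2) ^ k\<close>, so any \<open>r\<close> strictly between 1 and \<open>sqrt 2\<close> would do.

  The failure probability is controlled by the members lost so far, through the term
  \<open>(m - card I) / m\<close>: when no member is left it is 1, and while one is left after the last round
  there is no failure. As this term is linear in \<open>card I\<close>, taking its expectation over a round is
  immediate.
\<close>
lemma emeasure_all_costly_le:
  fixes G B \<kappa> m :: real
  assumes X: "finite X" and pos: "0 < G" "0 < B" "0 < \<kappa>" "0 < m" and B\<kappa>: "2 * B \<le> \<kappa>"
    and "4 \<le> B * (4/5) ^ k"
    and "spread_family m \<kappa> I F" and "\<And>i. i \<in> I \<Longrightarrow> F i \<subseteq> X" and "\<And>i. i \<in> I \<Longrightarrow> card (F i) < 2 ^ k"
  shows "emeasure (iid_exponential X (5 * G * (5/4) ^ k))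
      (all_costly X I F (64 * B / (7 * \<kappa> * G) * (32/25) ^ k))
    \<le> ennreal ((m - real (card I)) / m + 20 / B * (5/4) ^ k)"
  using assms(7-)
proof (induction k arbitrary: I F)
  case 0
  interpret P: prob_space "iid_exponential X (5 * G * (5/4) ^ 0)"
    using pos by (intro prob_space_iid_exponential) auto
  have "F i = {}" if "i \<in> I" for i
    using 0(3,4)[OF that] finite_subset[OF _ X] by auto
  then have cost: "(\<Sum>x\<in>F i. w x) = 0" if "i \<in> I" for i and w :: "'a \<Rightarrow> real"
    using that by simp
  show ?case
  proof (cases "I = {}")
    case True
    have "emeasure (iid_exponential X (5 * G * (5/4) ^ 0))
      (all_costly X I F (64 * B / (7 * \<kappa> * G) * (32/25) ^ 0)) \<le> ennreal 1"
      using P.emeasure_space_1 emeasure_space[of "iid_exponential X (5 * G * (5/4) ^ 0)"] by simp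
    also have "\<dots> \<le> ennreal ((m - real (card I)) / m + 20 / B * (5/4) ^ 0)"
      using True pos by (intro ennreal_leI) auto
    finally show ?thesis .
  next
    case False
    then obtain i where "i \<in> I" by blast
    have "0 \<le> 64 * B / (7 * \<kappa> * G)"
      using pos by simp
    then have "all_costly X I F (64 * B / (7 * \<kappa> * G) * (32/25) ^ 0) = {}"
      using cost[OF \<open>i \<in> I\<close>] \<open>i \<in> I\<close> by (auto simp: all_costly_def not_less intro!: bexI[of _ i])
    then show ?thesis by simp
  qed
next
  case (Suc k)
  define C where "C = B * (4/5) ^ Suc k"
  define u where "u = 5 * G * (5/4) ^ k"
  define v where "v = G * (5/4) ^ Suc k"
  define b where "b = 2 * C / (\<kappa> * v)"
  define p where "p = 1 - exp (- v * b)"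
  define a where "a = 64 * B / (7 * \<kappa> * G) * (32/25) ^ k"
  define \<epsilon> where "\<epsilon> = 20 / B * (5/4) ^ k"
  define J where "J = (\<lambda>W. {i \<in> I. card (fragment I F W i) < 2 ^ k})"
  let ?large = "\<lambda>W. {i \<in> I. 2 ^ k \<le> card (fragment I F W i)}"
  let ?w = "bernoulli_weight p X"
  have C: "4 \<le> C"
    using Suc.prems(1) by (simp add: C_def)
  have C_le: "C \<le> B"
    unfolding C_def using pos by (intro mult_left_le power_le_one) auto
  have I: "finite I"
    using Suc.prems(2) by (simp add: spread_family_def)
  have uv: "0 < u" "0 < v"
    using pos by (simp_all add: u_def v_def)
  have b0: "0 \<le> b"
    using pos uv C by (simp add: b_def)
  have vb: "v * b = 2 * C / \<kappa>"
    using uv by (simp add: b_def)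
  have p_ge: "C / \<kappa> \<le> p"
  proof -
    have "v * b \<le> 1" "0 \<le> v * b"
      using C C_le B\<kappa> pos by (simp_all add: vb)
    then have "v * b / 2 \<le> p"
      using exp_lower_half[of "v * b"] by (simp add: p_def)
    then show ?thesis by (simp add: vb)
  qed
  have p: "0 < p" "p \<le> 1"
    using p_ge C pos less_le_trans[of 0 "C / \<kappa>" p] by (auto simp: p_def)
  have p\<kappa>: "C \<le> p * \<kappa>"
    using p_ge pos by (simp add: field_simps)
  have w_nonneg: "0 \<le> ?w W" for W
    using p by (intro bernoulli_weight_nonneg) auto
  have IH: "emeasure (iid_exponential X u) (all_costly X (J W) (fragment I F W) a)
      \<le> ennreal ((m - real (card (J W))) / m + \<epsilon>)" for W
    unfolding u_def a_def \<epsilon>_def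
  proof (rule Suc.IH)
    have "B * (4/5) ^ Suc k \<le> B * (4/5) ^ k"
      using pos by (intro mult_left_mono power_decreasing) auto
    then show "4 \<le> B * (4/5) ^ k"
      using C by (simp add: C_def)
    show "spread_family m \<kappa> (J W) (fragment I F W)"
    proof (rule spread_family_shrink[OF Suc.prems(2)])
      show "fragment I F W i \<subseteq> F i" if "i \<in> J W" for i
        using that by (intro fragment_subset) (simp add: J_def)
    qed (auto simp: J_def)
    show "fragment I F W i \<subseteq> X" if "i \<in> J W" for i
      using that Suc.prems(3) fragment_subset[of i I F W] by (auto simp: J_def)
    show "card (fragment I F W i) < 2 ^ k" if "i \<in> J W" for i
      using that by (simp add: J_def)
  qed
  have bound_nonneg: "0 \<le> (m - real (card (J W))) / m + \<epsilon>" for W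
  proof -
    have "real (card (J W)) \<le> real (card I)"
      using I by (auto simp: J_def intro!: card_mono)
    then show ?thesis
      using spread_family_card_le[OF Suc.prems(2)] pos by (simp add: \<epsilon>_def)
  qed
  have card_J: "real (card (J W)) = real (card I) - real (card (?large W))" for W
  proof -
    have "card I = card (J W \<union> ?large W)"
      by (intro arg_cong[where f = card]) (auto simp: J_def)
    also have "\<dots> = card (J W) + card (?large W)"
      using I by (intro card_Un_disjoint) (auto simp: J_def)
    finally show ?thesis by simp
  qed
  have total: "(\<Sum>W\<in>Pow X. ?w W) = 1"
    using X by (rule sum_bernoulli_weight)
  have "emeasure (iid_exponential X (v + u)) (all_costly X I F (a + b * 2 ^ Suc k)) \<le>
      (\<Sum>W\<in>Pow X. ennreal (?w W) * emeasure (iid_exponential X u) (all_costly X (J W) (fragment I F W) a))"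
    unfolding p_def J_def
  proof (rule emeasure_all_costly_fragments[OF X I Suc.prems(3) _ uv b0])
    fix i assume "i \<in> I"
    then have "real (card (F i)) \<le> real (2 ^ Suc k)"
      using Suc.prems(4) by (intro of_nat_mono) (rule less_imp_le)
    then show "real (card (F i)) \<le> 2 ^ Suc k"
      by simp
  qed
  also have "\<dots> \<le> (\<Sum>W\<in>Pow X. ennreal (?w W) * ennreal ((m - real (card (J W))) / m + \<epsilon>))"
    by (intro sum_mono mult_left_mono IH) auto
  also have "\<dots> = ennreal (\<Sum>W\<in>Pow X. ?w W * ((m - real (card (J W))) / m + \<epsilon>))"
    using w_nonneg bound_nonneg
    by (subst sum_ennreal[symmetric]) (auto simp: ennreal_mult intro!: mult_nonneg_nonneg)
  also have "(\<Sum>W\<in>Pow X. ?w W * ((m - real (card (J W))) / m + \<epsilon>)) =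
      (\<Sum>W\<in>Pow X. ((m - real (card I)) / m + \<epsilon>) * ?w W + ?w W * real (card (?large W)) / m)"
  proof (rule sum.cong[OF refl])
    fix W
    have "(m - real (card (J W))) / m + \<epsilon> = (m - real (card I)) / m + \<epsilon> + real (card (?large W)) / m"
      by (simp add: card_J diff_divide_distrib)
    then show "?w W * ((m - real (card (J W))) / m + \<epsilon>) =
        ((m - real (card I)) / m + \<epsilon>) * ?w W + ?w W * real (card (?large W)) / m"
      by (simp only: distrib_left mult.commute times_divide_eq_right)
  qed
  also have "\<dots> = ((m - real (card I)) / m + \<epsilon>) + (\<Sum>W\<in>Pow X. ?w W * real (card (?large W))) / m"
    by (simp add: sum.distrib sum_distrib_left[symmetric] sum_divide_distrib[symmetric] total)
  \<comment> \<open>The exponent \<open>2 ^ k\<close> is at least 1, and already this crude use of it suffices.\<close>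
  also have "\<dots> \<le> ((m - real (card I)) / m + \<epsilon>) + 4 / C"
  proof -
    have "(\<Sum>W\<in>Pow X. ?w W * real (card (?large W))) \<le> m * 2 ^ 2 ^ Suc k / C ^ 2 ^ k"
      using Suc.prems p p\<kappa> pos C X
      by (intro expected_number_of_large_fragments[where k = \<kappa>]) (auto intro: less_imp_le)
    also have "(2::real) ^ 2 ^ Suc k = 4 ^ 2 ^ k"
      by (simp add: power_mult)
    also have "m * 4 ^ 2 ^ k / C ^ 2 ^ k = m * (4 / C) ^ 2 ^ k"
      by (simp add: power_divide)
    also have "\<dots> \<le> m * (4 / C) ^ 1"
      using pos C by (intro mult_left_mono power_decreasing) auto
    finally have "(\<Sum>W\<in>Pow X. ?w W * real (card (?large W))) / m \<le> 4 / C"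
      using pos by (simp add: divide_le_eq mult.commute)
    then show ?thesis by simp
  qed
  also have "\<dots> = (m - real (card I)) / m + 20 / B * (5/4) ^ Suc k"
  proof -
    have "(4/5::real) ^ k * (5/4) ^ k = 1"
      by (simp add: power_mult_distrib[symmetric])
    then have "4 / C = 5 / B * (5/4) ^ k"
      using pos by (simp add: C_def field_simps)
    then show ?thesis
      by (simp add: \<epsilon>_def)
  qed
  finally have *: "emeasure (iid_exponential X (v + u)) (all_costly X I F (a + b * 2 ^ Suc k)) \<le>
      ennreal ((m - real (card I)) / m + 20 / B * (5/4) ^ Suc k)"
    by (simp add: ennreal_leI)
  have "v + u = 5 * G * (5/4) ^ Suc k"
    by (simp add: u_def v_def)
  moreover have "a + b * 2 ^ Suc k = 64 * B / (7 * \<kappa> * G) * (32/25) ^ Suc k"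
  proof -
    have "b * 2 ^ Suc k = 2 * B / (\<kappa> * G) * ((4/5) ^ Suc k * 2 ^ Suc k / (5/4) ^ Suc k)"
      by (simp add: b_def C_def v_def)
    also have "(4/5::real) ^ Suc k * 2 ^ Suc k / (5/4) ^ Suc k = (32/25) ^ Suc k"
      by (simp only: power_mult_distrib[symmetric] power_divide[symmetric]) simp
    finally show ?thesis
      using pos by (simp add: a_def field_simps)
  qed
  ultimately show ?case
    using * by (simp only:)
qed

section \<open>Expected minimum cost over a spread family\<close>

lemma iid_exponential_coordinate:
  assumes "x \<in> X" "0 < l"
  shows "distributed (iid_exponential X l) lborel (\<lambda>w. w x) (exponential_density l)"
proof -
  let ?E = "density lborel (\<lambda>x. ennreal (exponential_density l x))"
  have "distr (iid_exponential X l) ?E (\<lambda>w. w x) = ?E"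
    unfolding iid_exponential_def
    using assms by (intro distr_PiM_component prob_space_exponential_density)
  moreover have "distr (iid_exponential X l) lborel (\<lambda>w. w x) = distr (iid_exponential X l) ?E (\<lambda>w. w x)"
    by (intro distr_cong) auto
  moreover have "(\<lambda>w. w x) \<in> measurable (iid_exponential X l) lborel"
    using assms measurable_component_singleton[of x X "\<lambda>_. borel"] by simp
  ultimately show ?thesis
    by (simp add: distributed_def)
qed

lemma indep_vars_iid_exponential:
  assumes ne: "X \<noteq> {}" and l: "0 < l"
  shows "prob_space.indep_vars (iid_exponential X l) (\<lambda>_. borel) (\<lambda>x w. w x) X"
proof -
  interpret prob_space "iid_exponential X l" by (rule prob_space_iid_exponential) fact
  have rv: "(\<lambda>w. w x) \<in> borel_measurable (iid_exponential X l)" if "x \<in> X" for x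
    using iid_exponential_coordinate[OF that l] by (simp add: distributed_def)
  have "distr (iid_exponential X l) (\<Pi>\<^sub>M x\<in>X. borel) (\<lambda>w. \<lambda>x\<in>X. w x) =
      distr (iid_exponential X l) (iid_exponential X l) (\<lambda>w. w)"
    by (intro distr_cong) (auto simp: space_iid_exponential)
  also have "\<dots> = iid_exponential X l"
    by (rule distr_id)
  also have "\<dots> = (\<Pi>\<^sub>M x\<in>X. distr (iid_exponential X l) borel (\<lambda>w. w x))"
    unfolding iid_exponential_def[of X l]
  proof (rule PiM_cong[OF refl])
    fix x assume "x \<in> X"
    from iid_exponential_coordinate[OF this l]
    have "density lborel (exponential_density l) = distr (iid_exponential X l) lborel (\<lambda>w. w x)"
      by (simp add: distributed_def)
    also have "\<dots> = distr (iid_exponential X l) borel (\<lambda>w. w x)"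
      by (intro distr_cong) auto
    finally show "density lborel (exponential_density l) =
      distr (Pi\<^sub>M X (\<lambda>x. density lborel (exponential_density l))) borel (\<lambda>w. w x)"
      by (simp add: iid_exponential_def)
  qed
  finally show ?thesis
    using indep_vars_iff_distr_eq_PiM'[OF ne rv] by simp
qed

lemma integrable_iid_exponential:
  assumes "x \<in> X" "0 < l"
  shows "integrable (iid_exponential X l) (\<lambda>w. w x)"
proof -
  interpret prob_space "iid_exponential X l" by (rule prob_space_iid_exponential) fact
  show ?thesis
    using erlang_ith_moment_integrable[OF assms(2) iid_exponential_coordinate[OF assms], of 1] by simp
qed

definition min_cost :: "'i set \<Rightarrow> ('i \<Rightarrow> 'a set) \<Rightarrow> ('a \<Rightarrow> real) \<Rightarrow> real" where
  "min_cost I F w = Min ((\<lambda>i. \<Sum>x\<in>F i. w x) ` I)"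

lemma min_cost_le: "finite I \<Longrightarrow> i \<in> I \<Longrightarrow> min_cost I F w \<le> (\<Sum>x\<in>F i. w x)"
  unfolding min_cost_def by (intro Min_le) auto

lemma min_cost_attained:
  assumes "finite I" "I \<noteq> {}"
  obtains i where "i \<in> I" "min_cost I F w = (\<Sum>x\<in>F i. w x)"
proof -
  have "min_cost I F w \<in> (\<lambda>i. \<Sum>x\<in>F i. w x) ` I"
    unfolding min_cost_def using assms by (intro Min_in) auto
  then show ?thesis using that by auto
qed

lemma min_cost_mono:
  assumes "finite I" "I \<noteq> {}" "\<And>i x. i \<in> I \<Longrightarrow> x \<in> F i \<Longrightarrow> w x \<le> w' x"
  shows "min_cost I F w \<le> min_cost I F w'"
proof -
  obtain i where i: "i \<in> I" "min_cost I F w' = (\<Sum>x\<in>F i. w' x)"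
    using assms by (rule_tac min_cost_attained)
  have "min_cost I F w \<le> (\<Sum>x\<in>F i. w x)"
    by (rule min_cost_le) fact+
  also have "\<dots> \<le> (\<Sum>x\<in>F i. w' x)"
    using assms i by (intro sum_mono)
  finally show ?thesis using i by simp
qed

lemma measurable_min_cost [measurable]:
  assumes "finite I" "\<And>i. i \<in> I \<Longrightarrow> F i \<subseteq> X"
  shows "min_cost I F \<in> borel_measurable (\<Pi>\<^sub>M x\<in>X. borel)"
proof -
  have "(\<lambda>w. Min ((\<lambda>i. \<Sum>x\<in>F i. w x) ` I)) \<in> borel_measurable (\<Pi>\<^sub>M x\<in>X. (borel :: real measure))"
    using assms by (intro borel_measurable_Min borel_measurable_sum measurable_component_singleton) auto
  then show ?thesis
    by (simp add: min_cost_def[abs_def])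
qed

lemma min_cost_scale:
  assumes "finite I" "I \<noteq> {}" "0 \<le> c"
  shows "min_cost I F (\<lambda>x. c * w x) = c * min_cost I F w"
proof (rule antisym)
  obtain i where i: "i \<in> I" "min_cost I F w = (\<Sum>x\<in>F i. w x)"
    using assms by (rule_tac min_cost_attained)
  then show "min_cost I F (\<lambda>x. c * w x) \<le> c * min_cost I F w"
    using min_cost_le[OF assms(1) i(1), of F "\<lambda>x. c * w x"] by (simp add: sum_distrib_left)
  obtain j where j: "j \<in> I" "min_cost I F (\<lambda>x. c * w x) = (\<Sum>x\<in>F j. c * w x)"
    using assms by (rule_tac min_cost_attained)
  then show "c * min_cost I F w \<le> min_cost I F (\<lambda>x. c * w x)"
    using min_cost_le[OF assms(1) j(1), of F w] assms(3)
    by (simp add: sum_distrib_left[symmetric] mult_left_mono)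
qed

lemma nn_integral_min_cost_half_rate:
  assumes X: "finite X" and I: "finite I" "I \<noteq> {}" and FX: "\<And>i. i \<in> I \<Longrightarrow> F i \<subseteq> X"
  shows "(\<integral>\<^sup>+w. ennreal (min_cost I F w) \<partial>iid_exponential X (1/2)) =
    2 * (\<integral>\<^sup>+w. ennreal (min_cost I F w) \<partial>iid_exponential X 1)"
proof -
  have [measurable]: "min_cost I F \<in> borel_measurable (\<Pi>\<^sub>M x\<in>X. borel)"
    using I(1) FX by (rule measurable_min_cost)
  have scale [measurable]: "(\<lambda>w. \<lambda>x\<in>X. 2 * w x) \<in> measurable (iid_exponential X 1) (\<Pi>\<^sub>M x\<in>X. (borel :: real measure))"
    by measurable
  have eq: "min_cost I F (\<lambda>x\<in>X. 2 * w x) = 2 * min_cost I F w" for w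
  proof -
    have "min_cost I F (\<lambda>x\<in>X. 2 * w x) = min_cost I F (\<lambda>x. 2 * w x)"
      unfolding min_cost_def using FX
      by (intro arg_cong[where f = Min] image_cong refl sum.cong) auto
    then show ?thesis
      using min_cost_scale[OF I, of 2] by simp
  qed
  have "(\<integral>\<^sup>+w. ennreal (min_cost I F w) \<partial>iid_exponential X (1/2)) =
      (\<integral>\<^sup>+w. ennreal (min_cost I F w) \<partial>distr (iid_exponential X 1) (\<Pi>\<^sub>M x\<in>X. borel) (\<lambda>w. \<lambda>x\<in>X. 2 * w x))"
    using iid_exponential_scale[OF X, of 1 2] by simp
  also have "\<dots> = (\<integral>\<^sup>+w. ennreal (min_cost I F (\<lambda>x\<in>X. 2 * w x)) \<partial>iid_exponential X 1)"
    by (rule nn_integral_distr[OF scale]) measurable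
  also have "\<dots> = (\<integral>\<^sup>+w. 2 * ennreal (min_cost I F w) \<partial>iid_exponential X 1)"
    by (simp add: eq ennreal_mult')
  also have "\<dots> = 2 * (\<integral>\<^sup>+w. ennreal (min_cost I F w) \<partial>iid_exponential X 1)"
    by (rule nn_integral_cmult) measurable
  finally show ?thesis .
qed

lemma nn_integral_min_cost_finite:
  assumes X: "finite X" and I: "finite I" "I \<noteq> {}" and FX: "\<And>i. i \<in> I \<Longrightarrow> F i \<subseteq> X"
  shows "(\<integral>\<^sup>+w. ennreal (min_cost I F w) \<partial>iid_exponential X 1) < \<infinity>"
proof -
  obtain i where i: "i \<in> I" using I by blast
  have "integrable (iid_exponential X 1) (\<lambda>w. \<Sum>x\<in>F i. w x)"
    using FX[OF i] by (intro Bochner_Integration.integrable_sum integrable_iid_exponential) auto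
  then have "(\<integral>\<^sup>+w. ennreal (norm (\<Sum>x\<in>F i. w x)) \<partial>iid_exponential X 1) < \<infinity>"
    by (simp add: integrable_iff_bounded)
  moreover have "(\<integral>\<^sup>+w. ennreal (min_cost I F w) \<partial>iid_exponential X 1) \<le>
      (\<integral>\<^sup>+w. ennreal (norm (\<Sum>x\<in>F i. w x)) \<partial>iid_exponential X 1)"
  proof (intro nn_integral_mono ennreal_leI)
    fix w
    have "min_cost I F w \<le> (\<Sum>x\<in>F i. w x)"
      by (rule min_cost_le[OF I(1) i])
    also have "\<dots> \<le> norm (\<Sum>x\<in>F i. w x)"
      by simp
    finally show "min_cost I F w \<le> norm (\<Sum>x\<in>F i. w x)" .
  qed
  ultimately show ?thesis by (rule le_less_trans[rotated])
qed

text \<open>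
  A bound on the failure probability already bounds the expectation. Split the weights of rate 1
  into two layers of rate \<open>1/2\<close>. If the first layer has a member of cost at most \<open>a\<close>, use it;
  otherwise, with probability at most \<open>1/4\<close>, fall back on the second layer, whose expected minimum
  cost is twice the expectation in question. Hence this expectation, being finite, is at most \<open>a\<close>
  plus half of itself.
\<close>
lemma nn_integral_min_cost_restart:
  fixes a :: real
  assumes X: "finite X" and I: "finite I" "I \<noteq> {}" and FX: "\<And>i. i \<in> I \<Longrightarrow> F i \<subseteq> X" and a: "0 \<le> a"
    and fail: "emeasure (iid_exponential X (1/2)) (all_costly X I F a) \<le> ennreal (1/4)"
  shows "(\<integral>\<^sup>+w. ennreal (min_cost I F w) \<partial>iid_exponential X 1) \<le> ennreal (2 * a)"
proof -
  let ?H = "iid_exponential X (1/2)"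
  let ?N = "\<integral>\<^sup>+w. ennreal (min_cost I F w) \<partial>iid_exponential X 1"
  interpret H: prob_space ?H by (rule prob_space_iid_exponential) simp
  have [measurable]: "min_cost I F \<in> borel_measurable (\<Pi>\<^sub>M x\<in>X. borel)"
    using I(1) FX by (rule measurable_min_cost)
  have [measurable]: "all_costly X I F a \<in> sets (\<Pi>\<^sub>M x\<in>X. (borel :: real measure))"
    using I(1) FX by (rule sets_all_costly)
  have pointwise: "ennreal (min_cost I F (\<lambda>x\<in>X. min (u x) (v x))) \<le>
      ennreal a + indicator (all_costly X I F a) u * ennreal (min_cost I F v)"
    if u: "u \<in> space ?H" for u v
  proof (cases "u \<in> all_costly X I F a")
    case True
    have "min_cost I F (\<lambda>x\<in>X. min (u x) (v x)) \<le> min_cost I F v"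
      using I FX by (intro min_cost_mono) auto
    then show ?thesis
      using True by (simp add: ennreal_leI add_increasing)
  next
    case False
    then obtain i where i: "i \<in> I" "(\<Sum>x\<in>F i. u x) \<le> a"
      using u by (auto simp: all_costly_def space_iid_exponential not_less)
    have "min_cost I F (\<lambda>x\<in>X. min (u x) (v x)) \<le> min_cost I F u"
      using I FX by (intro min_cost_mono) auto
    also have "\<dots> \<le> a"
      using min_cost_le[OF I(1) i(1), of F u] i(2) by simp
    finally show ?thesis
      using False by (simp add: ennreal_leI)
  qed
  have "?N = (\<integral>\<^sup>+u. \<integral>\<^sup>+v. ennreal (min_cost I F (\<lambda>x\<in>X. min (u x) (v x))) \<partial>?H \<partial>?H)"
    using nn_integral_iid_exponential_add[OF X, of "1/2" "1/2" "\<lambda>w. ennreal (min_cost I F w)"] by simp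
  also have "\<dots> \<le> (\<integral>\<^sup>+u. \<integral>\<^sup>+v. ennreal a + indicator (all_costly X I F a) u * ennreal (min_cost I F v) \<partial>?H \<partial>?H)"
    by (intro nn_integral_mono pointwise)
  also have "\<dots> = (\<integral>\<^sup>+u. ennreal a + indicator (all_costly X I F a) u * (2 * ?N) \<partial>?H)"
    by (simp add: nn_integral_add nn_integral_cmult H.emeasure_space_1
        nn_integral_min_cost_half_rate[OF X I FX])
  also have "\<dots> = ennreal a + emeasure ?H (all_costly X I F a) * (2 * ?N)"
    by (simp add: nn_integral_add nn_integral_multc H.emeasure_space_1)
  also have "\<dots> \<le> ennreal a + ennreal (1/4) * (2 * ?N)"
    by (intro add_left_mono mult_right_mono fail) simp
  finally have *: "?N \<le> ennreal a + ennreal (1/4) * (2 * ?N)" .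
  obtain r where r: "?N = ennreal r" "0 \<le> r"
    using nn_integral_min_cost_finite[OF X I, of F] FX by (cases ?N) auto
  have "2 * ?N = ennreal (2 * r)"
    using r by (simp add: ennreal_mult)
  then have "ennreal (1/4) * (2 * ?N) = ennreal (r / 2)"
    using r by (simp add: ennreal_mult[symmetric] del: ennreal_numeral)
  with * have "ennreal r \<le> ennreal (a + r / 2)"
    using r a by (simp add: ennreal_plus)
  then have "r \<le> a + r / 2"
    by (subst (asm) ennreal_le_iff) (use r a in auto)
  then have "r \<le> 2 * a"
    by simp
  then show ?thesis
    using r by (simp add: ennreal_leI)
qed

text \<open>
  The bound has no logarithmic factor because the rounds that need a large \<open>C\<close> have few points left
  to buy. The thresholds are sure to make points cheap with probability at least \<open>C / \<kappa>\<close> as long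
  as \<open>2 * C \<le> \<kappa>\<close>, and this is what the lower bound on \<open>\<kappa>\<close> provides: over \<open>K\<close> rounds \<open>C\<close> stays below
  \<open>80 * (5/4) ^ K\<close>, and \<open>(5/4) ^ K \<le> sqrt (2 ^ K) \<le> sqrt (2 * n)\<close>.
\<close>
theorem nn_integral_min_cost_spread:
  fixes \<kappa> :: real and n :: nat
  assumes X: "finite X" and ne: "I \<noteq> {}" and FX: "\<And>i. i \<in> I \<Longrightarrow> F i \<subseteq> X"
    and size: "\<And>i. i \<in> I \<Longrightarrow> card (F i) \<le> n" and n: "1 \<le> n"
    and spread: "spread_family (real (card I)) \<kappa> I F" and \<kappa>: "160 * sqrt (2 * real n) \<le> \<kappa>"
  shows "(\<integral>\<^sup>+w. ennreal (min_cost I F w) \<partial>iid_exponential X 1) \<le> ennreal (30000 * real n / \<kappa>)"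
proof -
  have I: "finite I"
    using spread by (simp add: spread_family_def)
  obtain K' where "2 ^ K' \<le> n" "n < 2 ^ (K' + 1)"
    using ex_power_ivl1[of 2 n] n by auto
  then obtain K where K: "n < 2 ^ K" "2 ^ K \<le> 2 * n"
    by (intro that[of "K' + 1"]) auto
  have K_real: "2 ^ K \<le> 2 * real n"
    using K(2) by (metis of_nat_le_iff of_nat_mult of_nat_numeral of_nat_power)
  define r :: real where "r = (5/4) ^ K"
  have r: "0 < r" by (simp add: r_def)
  have r2: "r * r * (32/25) ^ K = 2 ^ K"
    unfolding r_def power_mult_distrib[symmetric] by simp
  have "r * r = (25/16) ^ K"
    unfolding r_def power_mult_distrib[symmetric] by simp
  also have "\<dots> \<le> 2 ^ K"
    by (rule power_mono) auto
  also note K_real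
  finally have "r \<le> sqrt (2 * real n)"
    by (intro real_le_rsqrt) (simp add: power2_eq_square)
  with \<kappa> have r\<kappa>: "2 * (80 * r) \<le> \<kappa>" by simp
  then have \<kappa>0: "0 < \<kappa>" using r by simp
  have inv: "r * (4/5) ^ K = 1"
    unfolding r_def power_mult_distrib[symmetric] by simp
  \<comment> \<open>The choices \<open>B = 80 * r\<close> and \<open>G = 1 / (10 * r)\<close> make the failure probability \<open>1/4\<close> and the
     total rate of all layers \<open>1/2\<close>.\<close>
  define a where "a = 64 * (80 * r) / (7 * \<kappa> * (1 / (10 * r))) * (32/25) ^ K"
  have "emeasure (iid_exponential X (5 * (1 / (10 * r)) * (5/4) ^ K)) (all_costly X I F a)
      \<le> ennreal ((real (card I) - real (card I)) / real (card I) + 20 / (80 * r) * (5/4) ^ K)"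
    unfolding a_def
  proof (rule emeasure_all_costly_le[OF X])
    show "4 \<le> 80 * r * (4/5) ^ K"
      using inv by simp
    show "card (F i) < 2 ^ K" if "i \<in> I" for i
      using size[OF that] K(1) by simp
  qed (use r r\<kappa> \<kappa>0 spread FX I ne in \<open>auto simp: card_gt_0_iff\<close>)
  moreover have "5 * (1 / (10 * r)) * (5/4) ^ K = 1/2" "20 / (80 * r) * (5/4) ^ K = 1/4"
    using r by (simp_all add: r_def[symmetric])
  ultimately have fail: "emeasure (iid_exponential X (1/2)) (all_costly X I F a) \<le> ennreal (1/4)"
    by simp
  have "a = 51200 / (7 * \<kappa>) * (r * r * (32/25) ^ K)"
    using r \<kappa>0 by (simp add: a_def field_simps)
  also have "\<dots> = 51200 / (7 * \<kappa>) * 2 ^ K"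
    by (simp only: r2)
  also have "\<dots> \<le> 51200 / (7 * \<kappa>) * (2 * real n)"
    using K_real \<kappa>0 by (intro mult_left_mono) auto
  also have "\<dots> \<le> 15000 * real n / \<kappa>"
    using \<kappa>0 by (simp add: field_simps)
  finally have a_le: "2 * a \<le> 30000 * real n / \<kappa>" by simp
  have "0 \<le> a"
    using r \<kappa>0 by (simp add: a_def)
  then have "(\<integral>\<^sup>+w. ennreal (min_cost I F w) \<partial>iid_exponential X 1) \<le> ennreal (2 * a)"
    using fail by (intro nn_integral_min_cost_restart X I ne FX)
  also have "\<dots> \<le> ennreal (30000 * real n / \<kappa>)"
    by (rule ennreal_leI) fact
  finally show ?thesis .
qed

section \<open>Axial assignments\<close>

text \<open>
  Composing with the inverse of one permutation that takes the prescribed values leaves a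
  permutation that fixes \<open>B\<close> pointwise.
\<close>
lemma card_permutes_prescribed_le:
  assumes A: "finite A" and B: "B \<subseteq> A"
  shows "card {p. p permutes A \<and> (\<forall>a\<in>B. p a = f a)} \<le> fact (card A - card B)"
proof (cases "{p. p permutes A \<and> (\<forall>a\<in>B. p a = f a)} = {}")
  case True
  show ?thesis unfolding True by simp
next
  case False
  then obtain q where q: "q permutes A" "\<forall>a\<in>B. q a = f a" by blast
  let ?g = "\<lambda>p. inv q \<circ> p"
  have "card {p. p permutes A \<and> (\<forall>a\<in>B. p a = f a)} \<le> card {p. p permutes (A - B)}"
  proof (rule card_inj_on_le[where f = ?g])
    show "inj_on ?g {p. p permutes A \<and> (\<forall>a\<in>B. p a = f a)}"
    proof (rule inj_onI)
      fix p p' assume "?g p = ?g p'"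
      then have "q \<circ> (inv q \<circ> p) = q \<circ> (inv q \<circ> p')" by simp
      then show "p = p'"
        using permutes_inv_o(1)[OF q(1)] by (simp add: comp_assoc[symmetric])
    qed
    show "?g ` {p. p permutes A \<and> (\<forall>a\<in>B. p a = f a)} \<subseteq> {p. p permutes (A - B)}"
    proof clarify
      fix p assume p: "p permutes A" "\<forall>a\<in>B. p a = f a"
      have "?g p permutes A"
        using p(1) permutes_inv[OF q(1)] by (rule permutes_compose)
      moreover have "?g p a = a" if "a \<in> B" for a
        using that p(2) q permutes_inverses(2)[OF q(1), of a] by simp
      ultimately show "?g p permutes (A - B)"
        by (auto intro: permutes_superset)
    qed
    show "finite {p. p permutes (A - B)}"
      using A by (intro finite_permutations) auto
  qed
  also have "\<dots> = fact (card A - card B)"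
    using A B by (intro card_permutations) (auto simp: card_Diff_subset finite_subset)
  finally show ?thesis .
qed

text \<open>
  Prescribing \<open>s\<close> values of a permutation of \<open>n\<close> points reduces the number of permutations by a
  factor of at least \<open>(n / e) ^ s\<close>, because each step of the induction loses at most
  \<open>(1 + 1/m) ^ t \<le> exp (t / m) \<le> e\<close>.
\<close>
lemma power_fact_diff_le:
  "s \<le> n \<Longrightarrow> (real n / exp 1) ^ s * fact (n - s) \<le> fact n"
proof (induction s arbitrary: n)
  case (Suc t)
  then obtain m where n: "n = Suc m" and t: "t \<le> m"
    by (cases n) auto
  have "(real (Suc m)) ^ t \<le> exp 1 * real m ^ t"
  proof (cases "m = 0")
    case True
    then show ?thesis using t by simp
  next
    case False
    have "(1 + 1 / real m) ^ t \<le> exp (1 / real m) ^ t"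
      by (intro power_mono exp_ge_add_one_self) auto
    also have "\<dots> = exp (real t / real m)"
      by (simp add: exp_of_nat_mult[symmetric])
    also have "\<dots> \<le> exp 1"
      using t False by simp
    finally have "(1 + 1 / real m) ^ t * real m ^ t \<le> exp 1 * real m ^ t"
      by (intro mult_right_mono) auto
    moreover have "(1 + 1 / real m) * real m = real (Suc m)"
      using False by (simp add: field_simps)
    ultimately show ?thesis
      by (simp only: power_mult_distrib[symmetric])
  qed
  then have "real (Suc m) ^ t / exp 1 ^ t \<le> exp 1 * real m ^ t / exp 1 ^ t"
    by (intro divide_right_mono) auto
  then have *: "(real (Suc m) / exp 1) ^ t \<le> exp 1 * (real m / exp 1) ^ t"
    by (simp only: power_divide times_divide_eq_right)
  have "(real n / exp 1) ^ Suc t * fact (n - Suc t) =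
      real (Suc m) / exp 1 * ((real (Suc m) / exp 1) ^ t * fact (m - t))"
    by (simp add: n)
  also have "\<dots> \<le> real (Suc m) / exp 1 * (exp 1 * (real m / exp 1) ^ t * fact (m - t))"
    by (intro mult_left_mono mult_right_mono *) auto
  also have "\<dots> = real (Suc m) * ((real m / exp 1) ^ t * fact (m - t))"
    by simp
  also have "\<dots> \<le> real (Suc m) * fact m"
    using Suc.IH[OF t] by (intro mult_left_mono) auto
  finally show ?case
    by (simp add: n)
qed simp

text \<open>
  Axial assignments are parametrised by \<open>d - 1\<close> permutations: the point with first coordinate \<open>a\<close>
  has \<open>s i a\<close> as its coordinate number \<open>i\<close>, for \<open>i\<close> from 2 to \<open>d\<close>.
\<close>
definition permutation_tuples :: "nat \<Rightarrow> nat \<Rightarrow> (nat \<Rightarrow> nat \<Rightarrow> nat) set" where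
  "permutation_tuples d n = {2..d} \<rightarrow>\<^sub>E {p. p permutes {1..n}}"

definition tuple_graph :: "nat \<Rightarrow> nat \<Rightarrow> (nat \<Rightarrow> nat \<Rightarrow> nat) \<Rightarrow> (nat \<Rightarrow> nat) set" where
  "tuple_graph d n s = (\<lambda>a. \<lambda>i\<in>{1..d}. if i = 1 then a else s i a) ` {1..n}"

lemma finite_permutation_tuples: "finite (permutation_tuples d n)"
  unfolding permutation_tuples_def by (intro finite_PiE finite_permutations) auto

lemma card_permutation_tuples: "card (permutation_tuples d n) = fact n ^ (d - 1)"
  unfolding permutation_tuples_def by (simp add: card_PiE card_permutations)

lemma tuple_permutes:
  "s \<in> permutation_tuples d n \<Longrightarrow> i \<in> {1..d} \<Longrightarrow> i \<noteq> 1 \<Longrightarrow> s i permutes {1..n}"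
  by (auto simp: permutation_tuples_def PiE_iff)

lemma axial_assignment_tuple_graph:
  assumes s: "s \<in> permutation_tuples d n"
  shows "axial_assignment d n (tuple_graph d n s)"
proof -
  define g where "g i = (if i = 1 then id else s i)" for i
  have g: "g i permutes {1..n}" if "i \<in> {1..d}" for i
    using tuple_permutes[OF s that] by (auto simp: g_def permutes_id)
  have graph: "tuple_graph d n s = (\<lambda>a. \<lambda>i\<in>{1..d}. g i a) ` {1..n}"
    unfolding tuple_graph_def g_def by (intro image_cong refl restrict_ext) auto
  have "g i a \<in> {1..n}" if "i \<in> {1..d}" "a \<in> {1..n}" for i a
    using permutes_in_image[OF g[OF that(1)]] that(2) by blast
  then have sub: "tuple_graph d n s \<subseteq> cube d n"
    unfolding graph cube_def by (intro image_subsetI restrict_PiE_iff[THEN iffD2] ballI)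
  have "\<exists>!x. x \<in> tuple_graph d n s \<inter> axis_hyperplane d n i a" if i: "i \<in> {1..d}" and a: "a \<in> {1..n}" for i a
  proof (rule ex_ex1I)
    have "a \<in> g i ` {1..n}"
      unfolding permutes_image[OF g[OF i]] by (rule a)
    then obtain c where c: "c \<in> {1..n}" "g i c = a"
      by (elim imageE) simp
    let ?x = "\<lambda>j\<in>{1..d}. g j c"
    have "?x \<in> tuple_graph d n s"
      unfolding graph using c(1) by (rule imageI)
    moreover have "?x i = a"
      using i c(2) by simp
    ultimately have "?x \<in> tuple_graph d n s \<inter> axis_hyperplane d n i a"
      using sub unfolding axis_hyperplane_def by blast
    then show "\<exists>x. x \<in> tuple_graph d n s \<inter> axis_hyperplane d n i a" by (rule exI[where x = ?x])
  next
    fix x y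
    assume "x \<in> tuple_graph d n s \<inter> axis_hyperplane d n i a" "y \<in> tuple_graph d n s \<inter> axis_hyperplane d n i a"
    then obtain b c where "x = (\<lambda>j\<in>{1..d}. g j b)" "y = (\<lambda>j\<in>{1..d}. g j c)" "g i b = a" "g i c = a"
      using i by (auto simp: graph axis_hyperplane_def)
    moreover from this have "b = c"
      using permutes_inj[OF g[OF i]] by (auto dest: injD)
    ultimately show "x = y" by simp
  qed
  with sub show ?thesis by (simp add: axial_assignment_def)
qed

text \<open>
  If some graph contains \<open>U\<close>, then the points of \<open>U\<close> differ in their first coordinates, and
  containing \<open>U\<close> prescribes \<open>card U\<close> values of each of the \<open>d - 1\<close> permutations independently.
\<close>
lemma spread_tuple_graphs:
  assumes d: "d > 0" and n: "n > 0"
  shows "spread_family (real (card (permutation_tuples d n))) ((real n / exp 1) ^ (d - 1))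
    (permutation_tuples d n) (tuple_graph d n)"
  unfolding spread_family_def
proof (intro conjI allI impI finite_permutation_tuples)
  fix U :: "(nat \<Rightarrow> nat) set" assume U: "finite U"
  let ?T = "{s \<in> permutation_tuples d n. U \<subseteq> tuple_graph d n s}"
  let ?e = "real n / exp 1"
  show "real (card ?T) \<le> real (card (permutation_tuples d n)) / (?e ^ (d - 1)) ^ card U"
  proof (cases "?T = {}")
    case True
    then show ?thesis by (simp only: True) simp
  next
    case False
    then obtain q where q: "q \<in> permutation_tuples d n" "U \<subseteq> tuple_graph d n q" by blast
    let ?B = "(\<lambda>u. u 1) ` U"
    have graphD: "u 1 \<in> {1..n} \<and> (\<forall>i\<in>{2..d}. u i = s i (u 1)) \<and>
        u = (\<lambda>i\<in>{1..d}. if i = 1 then u 1 else s i (u 1))" if "u \<in> tuple_graph d n s" for u s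
      using that d by (auto simp: tuple_graph_def)
    have "inj_on (\<lambda>u. u 1) U"
    proof (rule inj_onI)
      fix u v :: "nat \<Rightarrow> nat" assume "u \<in> U" "v \<in> U" and uv: "u 1 = v 1"
      then have "u = (\<lambda>i\<in>{1..d}. if i = 1 then u 1 else q i (u 1))"
        "v = (\<lambda>i\<in>{1..d}. if i = 1 then v 1 else q i (v 1))"
        using q(2) graphD by blast+
      with uv show "u = v" by metis
    qed
    then have card_B: "card ?B = card U" by (rule card_image)
    have B: "?B \<subseteq> {1..n}"
      using q(2) graphD by blast
    then have U_le: "card U \<le> n"
      using card_mono[of "{1..n}" ?B] card_B by simp
    let ?P = "\<lambda>i. {p. p permutes {1..n} \<and> (\<forall>a\<in>?B. p a = q i a)}"
    have finP: "finite (?P i)" for i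
      by (rule finite_subset[OF _ finite_permutations[of "{1..n}"]]) auto
    have "?T \<subseteq> Pi\<^sub>E {2..d} ?P"
    proof
      fix s assume s: "s \<in> ?T"
      have "s i (u 1) = q i (u 1)" if "u \<in> U" "i \<in> {2..d}" for u i
      proof -
        have "u \<in> tuple_graph d n s" "u \<in> tuple_graph d n q"
          using s q(2) that(1) by auto
        then show ?thesis
          using graphD[of u s] graphD[of u q] that(2) by metis
      qed
      with s show "s \<in> Pi\<^sub>E {2..d} ?P"
        by (auto simp: permutation_tuples_def PiE_iff)
    qed
    then have "card ?T \<le> card (Pi\<^sub>E {2..d} ?P)"
      using finP by (intro card_mono finite_PiE) auto
    also have "\<dots> = (\<Prod>i\<in>{2..d}. card (?P i))"
      by (rule card_PiE) simp
    also have "\<dots> \<le> (\<Prod>i\<in>{2..d}. fact (n - card U))"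
      using card_permutes_prescribed_le[OF _ B] card_B by (intro prod_mono) auto
    also have "\<dots> = fact (n - card U) ^ (d - 1)"
      by simp
    finally have "card ?T \<le> fact (n - card U) ^ (d - 1)" .
    then have "real (card ?T) \<le> real (fact (n - card U) ^ (d - 1))"
      by (rule of_nat_mono)
    also have "\<dots> = fact (n - card U) ^ (d - 1)"
      by simp
    also have "\<dots> \<le> (fact n / ?e ^ card U) ^ (d - 1)"
      using power_fact_diff_le[OF U_le] n by (intro power_mono) (auto simp: pos_le_divide_eq mult.commute)
    also have "\<dots> = real (card (permutation_tuples d n)) / (?e ^ (d - 1)) ^ card U"
      by (simp add: card_permutation_tuples power_divide power_mult_distrib power_mult[symmetric] mult.commute)
    finally show ?thesis .
  qed
qed

lemma exp_weights_eq: "exp_weights d n = iid_exponential (cube d n) 1"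
  by (simp add: exp_weights_def iid_exponential_def)

lemma axial_assignment_first_coordinate:
  assumes S: "axial_assignment d n S" and d: "d > 0"
  shows "bij_betw (\<lambda>x. x 1) S {1..n}"
proof -
  have sub: "S \<subseteq> cube d n"
    using S by (simp add: axial_assignment_def)
  have one: "1 \<in> {1..d}" using d by simp
  have ex1: "\<exists>!x. x \<in> S \<inter> axis_hyperplane d n 1 a" if "a \<in> {1..n}" for a
    using S that one unfolding axial_assignment_def by blast
  have range: "x 1 \<in> {1..n}" if "x \<in> S" for x
    using that sub one by (auto simp: cube_def PiE_iff)
  show ?thesis
    unfolding bij_betw_def
  proof (intro conjI inj_onI equalityI subsetI)
    fix x y assume "x \<in> S" "y \<in> S" "x 1 = y 1"
    then have "x \<in> S \<inter> axis_hyperplane d n 1 (x 1)" "y \<in> S \<inter> axis_hyperplane d n 1 (x 1)"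
      using sub by (auto simp: axis_hyperplane_def)
    then show "x = y" using ex1[OF range[OF \<open>x \<in> S\<close>]] by blast
  next
    fix a assume "a \<in> {1..n}"
    then obtain x where "x \<in> S \<inter> axis_hyperplane d n 1 a"
      using ex1 by blast
    then show "a \<in> (\<lambda>x. x 1) ` S"
      by (auto simp: axis_hyperplane_def)
  qed (use range in auto)
qed

lemma min_axial_cost_le: "axial_assignment d n S \<Longrightarrow> min_axial_cost d n w \<le> (\<Sum>x\<in>S. w x)"
  unfolding min_axial_cost_def using finite_axial_assignments by (intro Min_le) auto

lemma cube_nonempty: "n > 0 \<Longrightarrow> cube d n \<noteq> {}"
  by (auto simp: cube_def PiE_eq_empty_iff)

lemma integrable_min_axial_cost:
  assumes "n > 0"
  shows "integrable (exp_weights d n) (min_axial_cost d n)"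
proof -
  interpret prob_space "exp_weights d n"
    unfolding exp_weights_eq by (rule prob_space_iid_exponential) simp
  show ?thesis
    using expectation_min_axial_cost(1)[OF assms, of "\<lambda>x w. w x"]
      indep_vars_iid_exponential[OF cube_nonempty[OF assms], of 1 d]
      iid_exponential_coordinate[of _ "cube d n" 1]
    by (simp add: exp_weights_eq)
qed

text \<open>
  Here \<open>\<kappa> = (n / e) ^ (d - 1)\<close>. For \<open>d \<ge> 2\<close> it is at least \<open>n / e\<close> and thus exceeds the required
  multiple of \<open>sqrt n\<close>. For \<open>d = 1\<close> it would be 1 and carry no information.
\<close>
lemma Z_axial_upper_spread:
  assumes d: "d \<ge> 2" and n: "n \<ge> 500000"
  shows "Z_axial d n \<le> 30000 * exp 1 ^ (d - 1) * (real n / real n ^ (d - 1))"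
proof -
  let ?I = "permutation_tuples d n" and ?F = "tuple_graph d n" and ?P = "iid_exponential (cube d n) 1"
  let ?\<kappa> = "(real n / exp 1) ^ (d - 1)"
  have e: "exp 1 \<le> (3::real)"
    by (rule exp_le)
  have graphs: "?F s \<subseteq> cube d n" "card (?F s) \<le> n" if "s \<in> ?I" for s
  proof -
    show "?F s \<subseteq> cube d n"
      using axial_assignment_tuple_graph[OF that] by (simp add: axial_assignment_def)
    show "card (?F s) \<le> n"
      unfolding tuple_graph_def using card_image_le[of "{1..n}"] by (metis card_atLeastAtMost diff_Suc_1 finite_atLeastAtMost)
  qed
  have ne: "?I \<noteq> {}"
    using card_permutation_tuples[of d n] by (metis card.empty fact_nonzero power_not_zero)
  have \<kappa>: "160 * sqrt (2 * real n) \<le> ?\<kappa>"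
  proof -
    \<comment> \<open>This is where 500000 comes from: it is the least positive \<open>n\<close> with \<open>2 * n \<le> (n / 500)\<^sup>2\<close>.\<close>
    have "sqrt (2 * real n) \<le> real n / 500"
      using n by (intro real_le_lsqrt) (auto simp: power2_eq_square field_simps)
    then have "160 * sqrt (2 * real n) \<le> real n / 3"
      by simp
    also have "\<dots> \<le> real n / exp 1"
      using e by (intro divide_left_mono) auto
    also have "\<dots> = (real n / exp 1) ^ 1"
      by simp
    also have "\<dots> \<le> ?\<kappa>"
      using d n e by (intro power_increasing) (auto simp: pos_le_divide_eq)
    finally show ?thesis .
  qed
  have "Z_axial d n = enn2real (\<integral>\<^sup>+w. ennreal (min_axial_cost d n w) \<partial>?P) - enn2real (\<integral>\<^sup>+w. ennreal (- min_axial_cost d n w) \<partial>?P)"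
    unfolding Z_axial_def using integrable_min_axial_cost[of n d] n
    by (subst real_lebesgue_integral_def) (auto simp: exp_weights_eq)
  also have "\<dots> \<le> enn2real (\<integral>\<^sup>+w. ennreal (min_axial_cost d n w) \<partial>?P)"
    by simp
  also have "\<dots> \<le> 30000 * real n / ?\<kappa>"
  proof (rule enn2real_leI)
    have "(\<integral>\<^sup>+w. ennreal (min_axial_cost d n w) \<partial>?P) \<le> (\<integral>\<^sup>+w. ennreal (min_cost ?I ?F w) \<partial>?P)"
    proof (intro nn_integral_mono ennreal_leI)
      fix w
      obtain s where "s \<in> ?I" "min_cost ?I ?F w = (\<Sum>x\<in>?F s. w x)"
        using finite_permutation_tuples ne by (rule min_cost_attained)
      then show "min_axial_cost d n w \<le> min_cost ?I ?F w"
        using min_axial_cost_le[OF axial_assignment_tuple_graph] by simp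
    qed
    also have "\<dots> \<le> ennreal (30000 * real n / ?\<kappa>)"
      using n d by (intro nn_integral_min_cost_spread finite_cube ne graphs spread_tuple_graphs \<kappa>) auto
    finally show "(\<integral>\<^sup>+w. ennreal (min_axial_cost d n w) \<partial>?P) \<le> ennreal (30000 * real n / ?\<kappa>)" .
  qed simp
  also have "\<dots> = 30000 * exp 1 ^ (d - 1) * (real n / real n ^ (d - 1))"
    by (simp add: power_divide)
  finally show ?thesis .
qed

text \<open>
  Any fixed assignment has \<open>n\<close> points of mean cost 1. This crude bound is sharp for \<open>d = 1\<close>, where
  the whole cube is the only assignment.
\<close>
lemma Z_axial_le:
  assumes d: "d > 0" and n: "n > 0"
  shows "Z_axial d n \<le> real n"
proof -
  interpret prob_space "exp_weights d n"
    unfolding exp_weights_eq by (rule prob_space_iid_exponential) simp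
  obtain S where S: "axial_assignment d n S"
    using axial_assignments_nonempty by blast
  have sub: "S \<subseteq> cube d n"
    using S by (simp add: axial_assignment_def)
  have int: "integrable (exp_weights d n) (\<lambda>w. w x)" if "x \<in> S" for x
    using that sub unfolding exp_weights_eq by (intro integrable_iid_exponential) auto
  have mean: "expectation (\<lambda>w. w x) = 1" if "x \<in> S" for x
    using that sub iid_exponential_coordinate[of x "cube d n" 1]
      exponential_distributed_expectation[of 1 "\<lambda>w. w x"] by (auto simp: exp_weights_eq)
  have "Z_axial d n \<le> expectation (\<lambda>w. \<Sum>x\<in>S. w x)"
    unfolding Z_axial_def using n S int
    by (intro integral_mono integrable_min_axial_cost Bochner_Integration.integrable_sum min_axial_cost_le)
  also have "\<dots> = real (card S)"
    using int mean by (subst Bochner_Integration.integral_sum) auto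
  also have "card S = n"
    using bij_betw_same_card[OF axial_assignment_first_coordinate[OF S d]] by simp
  finally show ?thesis .
qed

lemma card_axis_hyperplane:
  assumes "d > 0" "a \<in> {1..n}"
  shows "card (axis_hyperplane d n 1 a) = n ^ (d - 1)"
proof -
  have "axis_hyperplane d n 1 a = Pi\<^sub>E {1..d} (\<lambda>i. if i = 1 then {a} else {1..n})"
  proof (intro set_eqI iffI)
    fix x assume "x \<in> axis_hyperplane d n 1 a"
    then show "x \<in> Pi\<^sub>E {1..d} (\<lambda>i. if i = 1 then {a} else {1..n})"
      by (simp add: axis_hyperplane_def cube_def PiE_iff)
  next
    fix x assume x: "x \<in> Pi\<^sub>E {1..d} (\<lambda>i. if i = 1 then {a} else {1..n})"
    have "x 1 = a"
      using PiE_mem[OF x, of 1] assms(1) by simp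
    moreover have "x i \<in> {1..n}" if "i \<in> {1..d}" for i
      using PiE_mem[OF x that] \<open>x 1 = a\<close> assms(2) by (cases "i = 1") auto
    moreover have "x \<in> extensional {1..d}"
      using x by (simp add: PiE_iff)
    ultimately show "x \<in> axis_hyperplane d n 1 a"
      unfolding axis_hyperplane_def cube_def PiE_iff by blast
  qed
  then have "card (axis_hyperplane d n 1 a) = (\<Prod>i\<in>{1..d}. if i = 1 then 1 else n)"
    by (simp add: card_PiE if_distrib cong: if_cong)
  also have "\<dots> = (\<Prod>i\<in>insert 1 {2..d}. if i = 1 then 1 else n)"
    using assms by (intro prod.cong) auto
  also have "\<dots> = n ^ (d - 1)"
    by simp
  finally show ?thesis .
qed

text \<open>
  An assignment has one point in each of the \<open>n\<close> hyperplanes orthogonal to the first axis, and that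
  point costs at least as much as the cheapest point of the hyperplane, which is the minimum of
  \<open>n ^ (d - 1)\<close> independent exponentials and has mean \<open>1 / n ^ (d - 1)\<close>.
\<close>
lemma Z_axial_lower:
  assumes d: "d > 0" and n: "n > 0"
  shows "real n / real n ^ (d - 1) \<le> Z_axial d n"
proof -
  interpret prob_space "exp_weights d n"
    unfolding exp_weights_eq by (rule prob_space_iid_exponential) simp
  let ?H = "axis_hyperplane d n 1"
  let ?h = "\<lambda>a w. Min ((\<lambda>x. w x) ` ?H a)"
  have H: "?H a \<subseteq> cube d n" "finite (?H a)" for a
    using finite_subset[OF _ finite_cube[of d n]] by (auto simp: axis_hyperplane_def)
  have "real n ^ (d - 1) > 0" using n by simp
  have dist: "distributed (exp_weights d n) lborel (?h a) (exponential_density (real n ^ (d - 1)))"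
    if a: "a \<in> {1..n}" for a
  proof -
    have ne: "?H a \<noteq> {}"
      using card_axis_hyperplane[OF d a] n by (metis card.empty less_not_refl zero_less_power)
    have "distributed (exp_weights d n) lborel (?h a) (exponential_density (\<Sum>x\<in>?H a. 1))"
    proof (rule exponential_distributed_Min[OF H(2) ne])
      show "distributed (exp_weights d n) lborel (\<lambda>w. w x) (exponential_density 1)" if "x \<in> ?H a" for x
        unfolding exp_weights_eq by (rule iid_exponential_coordinate[OF subsetD[OF H(1) that]]) simp
      show "indep_vars (\<lambda>_. borel) (\<lambda>x w. w x) (?H a)"
        using indep_vars_iid_exponential[OF cube_nonempty[OF n], of 1 d]
        unfolding exp_weights_eq[symmetric] by (intro indep_vars_subset[OF _ H(1)]) simp
    qed simp
    then show ?thesis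
      using card_axis_hyperplane[OF d a] by simp
  qed
  have int: "integrable (exp_weights d n) (?h a)" if "a \<in> {1..n}" for a
    using erlang_ith_moment_integrable[OF \<open>real n ^ (d - 1) > 0\<close> dist[OF that], of 1] by simp
  have mean: "expectation (?h a) = 1 / real n ^ (d - 1)" if "a \<in> {1..n}" for a
    using exponential_distributed_expectation[OF \<open>real n ^ (d - 1) > 0\<close> dist[OF that]] .
  have "real n / real n ^ (d - 1) = (\<Sum>a\<in>{1..n}. expectation (?h a))"
    using mean by simp
  also have "\<dots> = expectation (\<lambda>w. \<Sum>a\<in>{1..n}. ?h a w)"
    using int by (intro Bochner_Integration.integral_sum[symmetric])
  also have "\<dots> \<le> Z_axial d n"
    unfolding Z_axial_def
  proof (intro integral_mono Bochner_Integration.integrable_sum int integrable_min_axial_cost n)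
    fix w
    have "min_axial_cost d n w \<in> (\<lambda>S. \<Sum>x\<in>S. w x) ` {S. axial_assignment d n S}"
      unfolding min_axial_cost_def using axial_assignments_nonempty finite_axial_assignments
      by (intro Min_in) auto
    then obtain S where S: "axial_assignment d n S" and eq: "min_axial_cost d n w = (\<Sum>x\<in>S. w x)"
      by auto
    have "(\<Sum>a\<in>{1..n}. ?h a w) = (\<Sum>x\<in>S. ?h (x 1) w)"
      by (rule sum.reindex_bij_betw[OF axial_assignment_first_coordinate[OF S d], symmetric])
    also have "\<dots> \<le> (\<Sum>x\<in>S. w x)"
      using S H(2) by (intro sum_mono Min_le) (auto simp: axial_assignment_def axis_hyperplane_def)
    finally show "(\<Sum>a\<in>{1..n}. ?h a w) \<le> min_axial_cost d n w"
      by (simp add: eq)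
  qed
  finally show ?thesis .
qed

lemma powi_two_minus:
  assumes "d > 0" "n > 0"
  shows "real n powi (- (int d - 2)) = real n / real n ^ (d - 1)"
proof -
  obtain e where e: "d = Suc e"
    using assms(1) by (cases d) auto
  then have "- (int d - 2) = 1 - int e"
    by simp
  then show ?thesis
    using assms(2) by (simp add: e power_int_diff)
qed

theorem corollary1p8:
  fixes d :: nat
  assumes "d > 0"
  shows "\<exists>c1 c2 :: real. c1 > 0 \<and> c2 > 0 \<and>
    (\<forall>\<^sub>F n in sequentially.
       c1 * real n powi (- (int d - 2)) \<le> Z_axial d n \<and>
       Z_axial d n \<le> c2 * real n powi (- (int d - 2)))"
proof (intro exI conjI)
  let ?c = "if d = 1 then 1 else 30000 * exp 1 ^ (d - 1) :: real"
  show "(0::real) < 1" "0 < ?c" by simp_all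
  show "\<forall>\<^sub>F n in sequentially. 1 * real n powi (- (int d - 2)) \<le> Z_axial d n \<and>
       Z_axial d n \<le> ?c * real n powi (- (int d - 2))"
    using eventually_ge_at_top[of 500000]
  proof eventually_elim
    case (elim n)
    then have n: "n > 0" by simp
    have "Z_axial d n \<le> ?c * (real n / real n ^ (d - 1))"
      using Z_axial_le[OF assms n] Z_axial_upper_spread[OF _ elim, of d] assms by (cases "d = 1") auto
    then show ?case
      using Z_axial_lower[OF assms n] unfolding powi_two_minus[OF assms n] mult_1 by blast
  qed
qed

end
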